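(* Let $\Bbbk$ be a field of characteristic different from $2$, $n\ge 1$, $A\in M_n(\Bbbk)$, and let $\chi$ be an infinitesimal $\mathcal{R}$-matrix for the quasitriangular Hopf algebra $(E(n),R_A)$. Then $(E(n),R_A,\chi)$ is Cartier if and only if $\chi$ is a $2$-coboundary, i.e. $\chi=1\otimes\alpha-\Delta(\alpha)+\alpha\otimes 1$ for some $\alpha\in E(n)$.
   Context: $E(n)$ is the $2^{n+1}$-dimensional Hopf algebra over $\Bbbk$ generated as an algebra by $g,x_1,\dots,x_n$ with relations $g^2=1$, $x_i^2=0$, $gx_i=-x_ig$, $x_ix_j=-x_jx_i$ for all $i,j$, and with $\Delta(g)=g\otimes g$, $\Delta(x_i)=x_i\otimes 1+g\otimes x_i$, $\varepsilon(g)=1$, $\varepsilon(x_i)=0$, $S(g)=g$, $S(x_i)=-gx_i$. For $P=\{i_1<\dots<i_s\}\subseteq\{1,\dots,n\}$ put $x_P=x_{i_1}\cdots x_{i_s}$, $x_\emptyset=1$. The quasitriangular structures on $E(n)$ are known to be exactly the elements, for $A\in M_n(\Bbbk)$, $$R_A=\tfrac12(1\otimes 1+1\otimes g+g\otimes 1-g\otimes g)+\tfrac12\sum_{|F|=|P|}(-1)^{\frac{|P|(|P|-1)}{2}}\det(P,F)\big(g^{|P|}x_F\otimes x_P+g^{|P|}x_F\otimes gx_P+g^{|P|+1}x_F\otimes x_P-g^{|P|+1}x_F\otimes gx_P\big),$$ where $P,F$ run over nonempty subsets of $\{1,\dots,n\}$ with $|F|=|P|$ and $\det(P,F)$ is the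 determinant of the submatrix of $A$ with rows indexed by $P$ and columns indexed by $F$. For a bialgebra $H$ and $T=\sum_i T^i\otimes T_i\in H\otimes H$ write $T_{12}=T\otimes 1$, $T_{23}=1\otimes T$, $T_{13}=\sum_i T^i\otimes 1\otimes T_i$, $T^{\mathrm{op}}=\sum_i T_i\otimes T^i$. A quasitriangular structure on $H$ is an invertible $\mathcal{R}\in H\otimes H$ with $\Delta^{\mathrm{op}}(h)=\mathcal{R}\Delta(h)\mathcal{R}^{-1}$ for all $h$, $(\mathrm{Id}\otimes\Delta)(\mathcal{R})=\mathcal{R}_{13}\mathcal{R}_{12}$, $(\Delta\otimes\mathrm{Id})(\mathcal{R})=\mathcal{R}_{13}\mathcal{R}_{23}$. An infinitesimal $\mathcal{R}$-matrix for $(H,\mathcal{R})$ is $\chi\in H\otimes H$ such that $\chi\Delta(h)=\Delta(h)\chi$ for all $h\in H$, $(\mathrm{Id}\otimes\Delta)(\chi)=\chi_{12}+\mathcal{R}_{12}^{-1}\chi_{13}\mathcal{R}_{12}$, and $(\Delta\otimes\mathrm{Id})(\chi)=\chi_{23}+\mathcal{R}_{23}^{-1}\chi_{13}\mathcal{R}_{23}$. In this case $(H,\mathcal{R},\chi)$ is Cartier if in addition $\mathcal{R}\chi=\chi^{\mathrm{op}}\mathcal{R}$. *)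

theory Defs
  imports "HOL-Analysis.Finite_Cartesian_Product" "Jordan_Normal_Form.Determinant"
begin

unbundle no vec_syntax

section \<open>Algebras with a signed monomial basis and their tensor products\<close>

text \<open>
  A finite basis in which the product of any two basis elements \<open>a\<close>, \<open>b\<close> is the
  basis element \<open>sb_mult a b\<close> times the integer \<open>sb_sign a b\<close> (below always 0, 1 or -1).
  The tensor product of two such algebras is again of this form, on pairs of basis elements.
\<close>

class signed_basis = finite +
  fixes sb_one :: 'a
    and sb_mult :: "'a \<Rightarrow> 'a \<Rightarrow> 'a"
    and sb_sign :: "'a \<Rightarrow> 'a \<Rightarrow> int"
  assumes sb_assoc: "sb_mult (sb_mult a b) c = sb_mult a (sb_mult b c)"
    and sb_one_left [simp]: "sb_mult sb_one a = a"
    and sb_one_right [simp]: "sb_mult a sb_one = a"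
    and sb_sign_assoc:
      "sb_sign a b * sb_sign (sb_mult a b) c = sb_sign b c * sb_sign a (sb_mult b c)"
    and sb_sign_one_left [simp]: "sb_sign sb_one a = 1"
    and sb_sign_one_right [simp]: "sb_sign a sb_one = 1"

text \<open>An element of the algebra is its family of coordinates over the basis \<open>'b\<close>.\<close>

typedef ('b, 'k) alg = "UNIV :: ('b \<Rightarrow> 'k) set"
  morphisms coeff_of Alg by simp

setup_lifting type_definition_alg

lemma alg_eqI: "(\<And>b. coeff_of u b = coeff_of v b) \<Longrightarrow> u = v"
  by (simp add: coeff_of_inject[symmetric] fun_eq_iff)

instantiation alg :: (signed_basis, comm_ring_1) ring_1
begin

lift_definition zero_alg :: "('a, 'b) alg" is "\<lambda>_. 0" .
lift_definition one_alg :: "('a, 'b) alg" is "\<lambda>a. if a = sb_one then 1 else 0" .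
lift_definition plus_alg :: "('a, 'b) alg \<Rightarrow> ('a, 'b) alg \<Rightarrow> ('a, 'b) alg"
  is "\<lambda>u v a. u a + v a" .
lift_definition uminus_alg :: "('a, 'b) alg \<Rightarrow> ('a, 'b) alg" is "\<lambda>u a. - u a" .
lift_definition minus_alg :: "('a, 'b) alg \<Rightarrow> ('a, 'b) alg \<Rightarrow> ('a, 'b) alg"
  is "\<lambda>u v a. u a - v a" .
lift_definition times_alg :: "('a, 'b) alg \<Rightarrow> ('a, 'b) alg \<Rightarrow> ('a, 'b) alg"
  is "\<lambda>u v c. \<Sum>a\<in>UNIV. \<Sum>b\<in>UNIV.
        if sb_mult a b = c then of_int (sb_sign a b) * (u a * v b) else 0" .

instance
proof
  fix u v w :: "('a, 'b) alg"
  have L: "coeff_of (u * v * w) d =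
      (\<Sum>a\<in>UNIV. \<Sum>b\<in>UNIV. \<Sum>x\<in>UNIV. if sb_mult (sb_mult a b) x = d
         then of_int (sb_sign a b * sb_sign (sb_mult a b) x) *
           (coeff_of u a * coeff_of v b * coeff_of w x) else 0)" for d
  proof -
    have "coeff_of (u * v * w) d =
       (\<Sum>c\<in>UNIV. \<Sum>x\<in>UNIV. \<Sum>a\<in>UNIV. \<Sum>b\<in>UNIV.
         if sb_mult a b = c then (if sb_mult c x = d
           then of_int (sb_sign a b * sb_sign c x) *
             (coeff_of u a * coeff_of v b * coeff_of w x) else 0) else 0)"
      unfolding times_alg.rep_eq
      by (intro sum.cong refl)
        (auto intro!: sum.cong sum.neutral simp: sum_distrib_left sum_distrib_right ac_simps)
    also have "\<dots> = (\<Sum>x\<in>UNIV. \<Sum>c\<in>UNIV. \<Sum>a\<in>UNIV. \<Sum>b\<in>UNIV.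
         if sb_mult a b = c then (if sb_mult c x = d
           then of_int (sb_sign a b * sb_sign c x) *
             (coeff_of u a * coeff_of v b * coeff_of w x) else 0) else 0)"
      by (rule sum.swap)
    also have "\<dots> = (\<Sum>x\<in>UNIV. \<Sum>a\<in>UNIV. \<Sum>c\<in>UNIV. \<Sum>b\<in>UNIV.
         if sb_mult a b = c then (if sb_mult c x = d
           then of_int (sb_sign a b * sb_sign c x) *
             (coeff_of u a * coeff_of v b * coeff_of w x) else 0) else 0)"
      by (intro sum.cong refl sum.swap)
    also have "\<dots> = (\<Sum>x\<in>UNIV. \<Sum>a\<in>UNIV. \<Sum>b\<in>UNIV. \<Sum>c\<in>UNIV.
         if sb_mult a b = c then (if sb_mult c x = d
           then of_int (sb_sign a b * sb_sign c x) *
             (coeff_of u a * coeff_of v b * coeff_of w x) else 0) else 0)"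
      by (intro sum.cong refl sum.swap)
    also have "\<dots> = (\<Sum>x\<in>UNIV. \<Sum>a\<in>UNIV. \<Sum>b\<in>UNIV.
         if sb_mult (sb_mult a b) x = d
           then of_int (sb_sign a b * sb_sign (sb_mult a b) x) *
             (coeff_of u a * coeff_of v b * coeff_of w x) else 0)"
      by (subst sum.delta', simp_all)
    also have "\<dots> = (\<Sum>a\<in>UNIV. \<Sum>x\<in>UNIV. \<Sum>b\<in>UNIV.
         if sb_mult (sb_mult a b) x = d
           then of_int (sb_sign a b * sb_sign (sb_mult a b) x) *
             (coeff_of u a * coeff_of v b * coeff_of w x) else 0)"
      by (rule sum.swap)
    also have "\<dots> = (\<Sum>a\<in>UNIV. \<Sum>b\<in>UNIV. \<Sum>x\<in>UNIV.
         if sb_mult (sb_mult a b) x = d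
           then of_int (sb_sign a b * sb_sign (sb_mult a b) x) *
             (coeff_of u a * coeff_of v b * coeff_of w x) else 0)"
      by (intro sum.cong refl sum.swap)
    finally show ?thesis .
  qed
  have R: "coeff_of (u * (v * w)) d =
      (\<Sum>a\<in>UNIV. \<Sum>b\<in>UNIV. \<Sum>x\<in>UNIV. if sb_mult a (sb_mult b x) = d
         then of_int (sb_sign b x * sb_sign a (sb_mult b x)) *
           (coeff_of u a * coeff_of v b * coeff_of w x) else 0)" for d
  proof -
    have "coeff_of (u * (v * w)) d =
       (\<Sum>a\<in>UNIV. \<Sum>c\<in>UNIV. \<Sum>b\<in>UNIV. \<Sum>x\<in>UNIV.
         if sb_mult b x = c then (if sb_mult a c = d
           then of_int (sb_sign b x * sb_sign a c) *
             (coeff_of u a * coeff_of v b * coeff_of w x) else 0) else 0)"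
      unfolding times_alg.rep_eq
      by (intro sum.cong refl)
        (auto intro!: sum.cong sum.neutral simp: sum_distrib_left sum_distrib_right ac_simps)
    also have "\<dots> = (\<Sum>a\<in>UNIV. \<Sum>b\<in>UNIV. \<Sum>c\<in>UNIV. \<Sum>x\<in>UNIV.
         if sb_mult b x = c then (if sb_mult a c = d
           then of_int (sb_sign b x * sb_sign a c) *
             (coeff_of u a * coeff_of v b * coeff_of w x) else 0) else 0)"
      by (intro sum.cong refl sum.swap)
    also have "\<dots> = (\<Sum>a\<in>UNIV. \<Sum>b\<in>UNIV. \<Sum>x\<in>UNIV. \<Sum>c\<in>UNIV.
         if sb_mult b x = c then (if sb_mult a c = d
           then of_int (sb_sign b x * sb_sign a c) *
             (coeff_of u a * coeff_of v b * coeff_of w x) else 0) else 0)"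
      by (intro sum.cong refl sum.swap)
    also have "\<dots> = (\<Sum>a\<in>UNIV. \<Sum>b\<in>UNIV. \<Sum>x\<in>UNIV.
         if sb_mult a (sb_mult b x) = d
         then of_int (sb_sign b x * sb_sign a (sb_mult b x)) *
           (coeff_of u a * coeff_of v b * coeff_of w x) else 0)"
      by (subst sum.delta', simp_all)
    finally show ?thesis .
  qed
  show "u * v * w = u * (v * w)"
    by (rule alg_eqI) (simp only: L R sb_assoc sb_sign_assoc)
  have "coeff_of (1 * u) d = coeff_of u d" for d
  proof -
    have "coeff_of (1 * u) d = (\<Sum>a\<in>(UNIV :: 'a set). if a = sb_one
        then (\<Sum>b\<in>UNIV. if b = d then coeff_of u b else 0) else 0)"
      unfolding times_alg.rep_eq one_alg.rep_eq
      by (rule sum.cong[OF refl]) (auto intro!: sum.cong sum.neutral simp del: sum.delta sum.delta')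
    then show ?thesis by simp
  qed
  then show "1 * u = u" by (rule alg_eqI)
  have "coeff_of (u * 1) d = coeff_of u d" for d
  proof -
    have "coeff_of (u * 1) d = (\<Sum>a\<in>UNIV. \<Sum>b\<in>(UNIV :: 'a set). if b = sb_one
        then (if a = d then coeff_of u a else 0) else 0)"
      unfolding times_alg.rep_eq one_alg.rep_eq
      by (rule sum.cong[OF refl]) (auto intro!: sum.cong sum.neutral simp del: sum.delta sum.delta')
    then show ?thesis by simp
  qed
  then show "u * 1 = u" by (rule alg_eqI)
  show "(u + v) * w = u * w + v * w"
    by (rule alg_eqI)
      (simp only: times_alg.rep_eq plus_alg.rep_eq sum.distrib[symmetric],
        intro sum.cong refl, simp add: algebra_simps)
  show "u * (v + w) = u * v + u * w"
    by (rule alg_eqI)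
      (simp only: times_alg.rep_eq plus_alg.rep_eq sum.distrib[symmetric],
        intro sum.cong refl, simp add: algebra_simps)
  have "coeff_of (0 :: ('a, 'b) alg) sb_one \<noteq> coeff_of 1 sb_one"
    by (simp add: zero_alg.rep_eq one_alg.rep_eq)
  then show "(0 :: ('a, 'b) alg) \<noteq> 1" by metis
qed (rule alg_eqI, simp add: plus_alg.rep_eq zero_alg.rep_eq uminus_alg.rep_eq
      minus_alg.rep_eq algebra_simps)+

end

lift_definition scal :: "'k::comm_ring_1 \<Rightarrow> ('b, 'k) alg \<Rightarrow> ('b, 'k) alg"  (infixr "*\<^sub>k" 75)
  is "\<lambda>c u b. c * u b" .

lift_definition basis :: "'b \<Rightarrow> ('b, 'k::comm_ring_1) alg"
  is "\<lambda>a b. if b = a then 1 else 0" .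

instantiation prod :: (signed_basis, signed_basis) signed_basis
begin

definition sb_one_prod :: "'a \<times> 'b" where "sb_one_prod = (sb_one, sb_one)"
definition sb_mult_prod :: "'a \<times> 'b \<Rightarrow> 'a \<times> 'b \<Rightarrow> 'a \<times> 'b" where
  "sb_mult_prod p q = (sb_mult (fst p) (fst q), sb_mult (snd p) (snd q))"
definition sb_sign_prod :: "'a \<times> 'b \<Rightarrow> 'a \<times> 'b \<Rightarrow> int" where
  "sb_sign_prod p q = sb_sign (fst p) (fst q) * sb_sign (snd p) (snd q)"

instance
proof
  fix a b c :: "'a \<times> 'b"
  have "sb_sign a b * sb_sign (sb_mult a b) c =
     (sb_sign (fst a) (fst b) * sb_sign (sb_mult (fst a) (fst b)) (fst c)) *
     (sb_sign (snd a) (snd b) * sb_sign (sb_mult (snd a) (snd b)) (snd c))"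
    by (simp add: sb_sign_prod_def sb_mult_prod_def)
  then show "sb_sign a b * sb_sign (sb_mult a b) c = sb_sign b c * sb_sign a (sb_mult b c)"
    by (simp add: sb_sign_assoc) (simp add: sb_sign_prod_def sb_mult_prod_def)
qed (simp_all add: sb_one_prod_def sb_mult_prod_def sb_sign_prod_def sb_assoc)

end

text \<open>
  \<open>('b \<times> 'b, 'k) alg\<close> is \<open>H \<otimes> H\<close> and \<open>('b \<times> 'b \<times> 'b, 'k) alg\<close> is \<open>H \<otimes> H \<otimes> H\<close>, where
  \<open>H = ('b, 'k) alg\<close>; the pair \<open>(a, b)\<close> is the basis element \<open>a \<otimes> b\<close>.
\<close>

lift_definition tens :: "('a, 'k::comm_ring_1) alg \<Rightarrow> ('b, 'k) alg \<Rightarrow> ('a \<times> 'b, 'k) alg"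
  (infixr "\<otimes>\<^sub>k" 73)
  is "\<lambda>u v (a, b). u a * v b" .

lift_definition reassoc :: "(('a \<times> 'b) \<times> 'c, 'k) alg \<Rightarrow> ('a \<times> 'b \<times> 'c, 'k) alg"
  is "\<lambda>u (a, b, c). u ((a, b), c)" .

lift_definition flip_legs :: "('a \<times> 'b, 'k) alg \<Rightarrow> ('b \<times> 'a, 'k) alg"
  is "\<lambda>u (a, b). u (b, a)" .

lemma mult_scal_left [simp]: "(c *\<^sub>k u) * v = c *\<^sub>k (u * v)"
  for u v :: "('b::signed_basis, 'k::comm_ring_1) alg"
  by (rule alg_eqI)
    (auto simp: times_alg.rep_eq scal.rep_eq sum_distrib_left ac_simps intro!: sum.cong)

lemma mult_scal_right [simp]: "u * (c *\<^sub>k v) = c *\<^sub>k (u * v)"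
  for u v :: "('b::signed_basis, 'k::comm_ring_1) alg"
  by (rule alg_eqI)
    (auto simp: times_alg.rep_eq scal.rep_eq sum_distrib_left ac_simps intro!: sum.cong)

lemma scal_scal [simp]: "c *\<^sub>k d *\<^sub>k u = (c * d) *\<^sub>k u"
  by (rule alg_eqI) (simp add: scal.rep_eq ac_simps)

lemma scal_one [simp]: "1 *\<^sub>k u = u"
  by (rule alg_eqI) (simp add: scal.rep_eq)

lemma scal_add_left: "(c + d) *\<^sub>k u = c *\<^sub>k u + d *\<^sub>k (u :: ('b::signed_basis, 'k::comm_ring_1) alg)"
  by (rule alg_eqI) (simp add: scal.rep_eq plus_alg.rep_eq algebra_simps)

lemma scal_add_right: "c *\<^sub>k (u + v) = c *\<^sub>k u + c *\<^sub>k (v :: ('b::signed_basis, 'k::comm_ring_1) alg)"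
  by (rule alg_eqI) (simp add: scal.rep_eq plus_alg.rep_eq algebra_simps)

lemma scal_zero_left [simp]: "0 *\<^sub>k u = (0 :: ('b::signed_basis, 'k::comm_ring_1) alg)"
  by (rule alg_eqI) (simp add: scal.rep_eq zero_alg.rep_eq)

lemma scal_zero_right [simp]: "c *\<^sub>k 0 = (0 :: ('b::signed_basis, 'k::comm_ring_1) alg)"
  by (rule alg_eqI) (simp add: scal.rep_eq zero_alg.rep_eq)

lemma scal_minus_left [simp]: "(- c) *\<^sub>k u = - (c *\<^sub>k (u :: ('b::signed_basis, 'k::comm_ring_1) alg))"
  by (rule alg_eqI) (simp add: scal.rep_eq uminus_alg.rep_eq)

lemma scal_minus_right [simp]: "c *\<^sub>k (- u) = - (c *\<^sub>k (u :: ('b::signed_basis, 'k::comm_ring_1) alg))"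
  by (rule alg_eqI) (simp add: scal.rep_eq uminus_alg.rep_eq)

lemma coeff_of_sum: "coeff_of (sum f S) b = (\<Sum>s\<in>S. coeff_of (f s) b)"
  for f :: "'s \<Rightarrow> ('b::signed_basis, 'k::comm_ring_1) alg"
  by (induction S rule: infinite_finite_induct) (simp_all add: zero_alg.rep_eq plus_alg.rep_eq)

lemma basis_expansion: "u = (\<Sum>b\<in>UNIV. coeff_of u b *\<^sub>k basis b)"
  for u :: "('b::signed_basis, 'k::comm_ring_1) alg"
  by (rule alg_eqI) (simp add: coeff_of_sum scal.rep_eq basis.rep_eq if_distrib cong: if_cong)

lemma basis_one: "basis sb_one = (1 :: ('b::signed_basis, 'k::comm_ring_1) alg)"
  by (rule alg_eqI) (simp add: basis.rep_eq one_alg.rep_eq)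

lemma basis_mult:
  "basis a * basis b = (of_int (sb_sign a b) *\<^sub>k basis (sb_mult a b) ::
     ('b::signed_basis, 'k::comm_ring_1) alg)"
proof (rule alg_eqI)
  fix c
  have "coeff_of (basis a * basis b :: ('b, 'k) alg) c =
      (\<Sum>x\<in>UNIV. if x = a then (\<Sum>y\<in>UNIV. if y = b then
        (if sb_mult a b = c then of_int (sb_sign a b) else 0) else 0) else 0)"
    unfolding times_alg.rep_eq basis.rep_eq
    by (rule sum.cong[OF refl]) (auto intro!: sum.cong sum.neutral simp del: sum.delta sum.delta')
  then show "coeff_of (basis a * basis b :: ('b, 'k) alg) c =
      coeff_of (of_int (sb_sign a b) *\<^sub>k basis (sb_mult a b)) c"
    by (simp add: scal.rep_eq basis.rep_eq)
qed

lemma tens_basis: "basis a \<otimes>\<^sub>k basis b = (basis (a, b) :: (_, 'k::comm_ring_1) alg)"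
  by (rule alg_eqI) (auto simp: tens.rep_eq basis.rep_eq split: prod.splits)

lemma tens_one: "1 \<otimes>\<^sub>k 1 = (1 :: ('a::signed_basis \<times> 'b::signed_basis, 'k::comm_ring_1) alg)"
  by (rule alg_eqI) (auto simp: tens.rep_eq one_alg.rep_eq sb_one_prod_def split: prod.splits)

lemma sum_UNIV_prod: "sum f UNIV = (\<Sum>a\<in>UNIV. \<Sum>b\<in>UNIV. f (a, b))"
  by (simp add: sum.cartesian_product)

lemma tens_mult: "(u \<otimes>\<^sub>k v) * (u' \<otimes>\<^sub>k v') = (u * u') \<otimes>\<^sub>k (v * v')"
  for u u' :: "('a::signed_basis, 'k::comm_ring_1) alg" and v v' :: "('b::signed_basis, 'k) alg"
proof (rule alg_eqI, clarify)
  fix c d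
  have "coeff_of ((u \<otimes>\<^sub>k v) * (u' \<otimes>\<^sub>k v')) (c, d) =
    (\<Sum>a\<in>UNIV. \<Sum>b\<in>UNIV. \<Sum>a'\<in>UNIV. \<Sum>b'\<in>UNIV.
      (if sb_mult a a' = c then of_int (sb_sign a a') * (coeff_of u a * coeff_of u' a') else 0) *
      (if sb_mult b b' = d then of_int (sb_sign b b') * (coeff_of v b * coeff_of v' b') else 0))"
    unfolding times_alg.rep_eq tens.rep_eq sum_UNIV_prod
    by (intro sum.cong refl)
      (auto simp: sb_mult_prod_def sb_sign_prod_def)
  also have "\<dots> = (\<Sum>a\<in>UNIV. \<Sum>a'\<in>UNIV. \<Sum>b\<in>UNIV. \<Sum>b'\<in>UNIV.
      (if sb_mult a a' = c then of_int (sb_sign a a') * (coeff_of u a * coeff_of u' a') else 0) *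
      (if sb_mult b b' = d then of_int (sb_sign b b') * (coeff_of v b * coeff_of v' b') else 0))"
    by (intro sum.cong refl sum.swap)
  also have "\<dots> = coeff_of ((u * u') \<otimes>\<^sub>k (v * v')) (c, d)"
    unfolding times_alg.rep_eq tens.rep_eq
    by (simp only: sum_distrib_right prod.case) (simp only: sum_distrib_left)
  finally show "coeff_of ((u \<otimes>\<^sub>k v) * (u' \<otimes>\<^sub>k v')) (c, d) = coeff_of ((u * u') \<otimes>\<^sub>k (v * v')) (c, d)" .
qed

section \<open>Infinitesimal R-matrices and Cartier triples\<close>

definition ring_inv :: "'a::ring_1 \<Rightarrow> 'a" where
  "ring_inv x = (THE y. x * y = 1 \<and> y * x = 1)"

lemma ring_inv_eq:
  assumes "x * y = 1" "y * x = 1"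
  shows "ring_inv x = y"
  unfolding ring_inv_def
proof (rule the_equality)
  fix z assume "x * z = 1 \<and> z * x = 1"
  then show "z = y" using assms by (metis mult.assoc mult_1_left mult_1_right)
qed (use assms in simp)

definition leg12 :: "('b::signed_basis \<times> 'b, 'k::comm_ring_1) alg \<Rightarrow> ('b \<times> 'b \<times> 'b, 'k) alg" where
  "leg12 T = reassoc (T \<otimes>\<^sub>k 1)"

definition leg23 :: "('b::signed_basis \<times> 'b, 'k::comm_ring_1) alg \<Rightarrow> ('b \<times> 'b \<times> 'b, 'k) alg" where
  "leg23 T = 1 \<otimes>\<^sub>k T"

definition leg13 :: "('b::signed_basis \<times> 'b, 'k::comm_ring_1) alg \<Rightarrow> ('b \<times> 'b \<times> 'b, 'k) alg" where
  "leg13 T = (\<Sum>(a, b)\<in>UNIV. coeff_of T (a, b) *\<^sub>k (basis a \<otimes>\<^sub>k 1 \<otimes>\<^sub>k basis b))"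

definition id_tens ::
  "(('b, 'k) alg \<Rightarrow> ('b \<times> 'b, 'k) alg) \<Rightarrow>
   ('b::signed_basis \<times> 'b, 'k::comm_ring_1) alg \<Rightarrow> ('b \<times> 'b \<times> 'b, 'k) alg" where
  "id_tens \<Delta> T = (\<Sum>(a, b)\<in>UNIV. coeff_of T (a, b) *\<^sub>k (basis a \<otimes>\<^sub>k \<Delta> (basis b)))"

definition tens_id ::
  "(('b, 'k) alg \<Rightarrow> ('b \<times> 'b, 'k) alg) \<Rightarrow>
   ('b::signed_basis \<times> 'b, 'k::comm_ring_1) alg \<Rightarrow> ('b \<times> 'b \<times> 'b, 'k) alg" where
  "tens_id \<Delta> T = (\<Sum>(a, b)\<in>UNIV. coeff_of T (a, b) *\<^sub>k reassoc (\<Delta> (basis a) \<otimes>\<^sub>k basis b))"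

text \<open>
  In the next two definitions \<open>\<Delta>\<close> is the comultiplication of a bialgebra and \<open>R\<close> a
  quasitriangular structure on it; in particular \<open>R\<close>, hence \<open>leg12 R\<close> and \<open>leg23 R\<close>, is
  invertible, and \<open>ring_inv\<close> is the actual inverse.
\<close>

definition infinitesimal_R_matrix ::
  "(('b, 'k) alg \<Rightarrow> ('b \<times> 'b, 'k) alg) \<Rightarrow> ('b::signed_basis \<times> 'b, 'k::comm_ring_1) alg \<Rightarrow>
   ('b \<times> 'b, 'k) alg \<Rightarrow> bool" where
  "infinitesimal_R_matrix \<Delta> R \<chi> \<longleftrightarrow>
     (\<forall>h. \<chi> * \<Delta> h = \<Delta> h * \<chi>) \<and>
     id_tens \<Delta> \<chi> = leg12 \<chi> + ring_inv (leg12 R) * leg13 \<chi> * leg12 R \<and>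
     tens_id \<Delta> \<chi> = leg23 \<chi> + ring_inv (leg23 R) * leg13 \<chi> * leg23 R"

definition cartier ::
  "(('b, 'k) alg \<Rightarrow> ('b \<times> 'b, 'k) alg) \<Rightarrow> ('b::signed_basis \<times> 'b, 'k::comm_ring_1) alg \<Rightarrow>
   ('b \<times> 'b, 'k) alg \<Rightarrow> bool" where
  "cartier \<Delta> R \<chi> \<longleftrightarrow> infinitesimal_R_matrix \<Delta> R \<chi> \<and> R * \<chi> = flip_legs \<chi> * R"

definition two_coboundary ::
  "(('b, 'k) alg \<Rightarrow> ('b \<times> 'b, 'k) alg) \<Rightarrow> ('b::signed_basis \<times> 'b, 'k::comm_ring_1) alg \<Rightarrow> bool" where
  "two_coboundary \<Delta> \<chi> \<longleftrightarrow> (\<exists>\<alpha>. \<chi> = 1 \<otimes>\<^sub>k \<alpha> - \<Delta> \<alpha> + \<alpha> \<otimes>\<^sub>k 1)"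

section \<open>The Hopf algebra E(n)\<close>

text \<open>
  The index set \<open>{1, \<dots>, n}\<close> is a finite linearly ordered type \<open>'n\<close>, so \<open>n = CARD('n)\<close>.
  The basis element \<open>GX a P\<close> is \<open>g x\<^sub>P\<close> if \<open>a\<close> holds and \<open>x\<^sub>P\<close> otherwise. The sign of a product
  comes from sorting: moving \<open>g\<close> to the left past \<open>x\<^sub>P\<close> costs \<open>card P\<close> transpositions, and
  \<open>x\<^sub>P x\<^sub>Q\<close> is 0 if \<open>P\<close>, \<open>Q\<close> meet and \<open>x\<close> of the union up to the parity of the number of
  inversions otherwise.
\<close>

datatype 'n ebasis = GX bool "'n set"

definition inversions :: "'n::linorder set \<Rightarrow> 'n set \<Rightarrow> nat" where
  "inversions P Q = card {(p, q). p \<in> P \<and> q \<in> Q \<and> q < p}"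

lemma inversions_Un_left:
  fixes P :: "'n::{finite,linorder} set"
  assumes "P \<inter> P' = {}"
  shows "inversions (P \<union> P') Q = inversions P Q + inversions P' Q"
  unfolding inversions_def
  by (subst card_Un_disjoint[symmetric]) (use assms in \<open>auto intro!: arg_cong[where f=card]\<close>)

lemma inversions_Un_right:
  fixes P :: "'n::{finite,linorder} set"
  assumes "Q \<inter> Q' = {}"
  shows "inversions P (Q \<union> Q') = inversions P Q + inversions P Q'"
  unfolding inversions_def
  by (subst card_Un_disjoint[symmetric]) (use assms in \<open>auto intro!: arg_cong[where f=card]\<close>)

lemma inversions_singleton: "inversions {p} Q = card {q \<in> Q. q < p}"
proof -
  have "{(p', q). p' \<in> {p} \<and> q \<in> Q \<and> q < p'} = Pair p ` {q \<in> Q. q < p}" by auto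
  then show ?thesis by (simp add: inversions_def card_image inj_on_def)
qed

lemma inversions_empty [simp]: "inversions {} Q = 0" "inversions P {} = 0"
  by (simp_all add: inversions_def)

instantiation ebasis :: ("{finite,linorder}") signed_basis
begin

definition sb_one_ebasis :: "'a ebasis" where "sb_one_ebasis = GX False {}"

fun sb_mult_ebasis :: "'a ebasis \<Rightarrow> 'a ebasis \<Rightarrow> 'a ebasis" where
  "sb_mult_ebasis (GX a P) (GX b Q) = GX (a \<noteq> b) (P \<union> Q)"

fun sb_sign_ebasis :: "'a ebasis \<Rightarrow> 'a ebasis \<Rightarrow> int" where
  "sb_sign_ebasis (GX a P) (GX b Q) =
     (if P \<inter> Q = {} then (-1) ^ ((if b then card P else 0) + inversions P Q) else 0)"

instance
proof
  have "(UNIV :: 'a ebasis set) = (\<lambda>(a, P). GX a P) ` UNIV"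
    by (auto simp: image_iff) (metis ebasis.exhaust)
  then show "finite (UNIV :: 'a ebasis set)" by (metis finite finite_imageI)
  fix x y z :: "'a ebasis"
  obtain a P b Q c R where [simp]: "x = GX a P" "y = GX b Q" "z = GX c R"
    by (metis ebasis.exhaust)
  show "sb_mult (sb_mult x y) z = sb_mult x (sb_mult y z)" by auto
  show "sb_mult sb_one x = x" "sb_mult x sb_one = x" "sb_sign sb_one x = 1" "sb_sign x sb_one = 1"
    by (simp_all add: sb_one_ebasis_def)
  show "sb_sign x y * sb_sign (sb_mult x y) z = sb_sign y z * sb_sign x (sb_mult y z)"
  proof (cases "P \<inter> Q = {} \<and> P \<inter> R = {} \<and> Q \<inter> R = {}")
    case True
    then have "card (P \<union> Q) = card P + card Q" by (simp add: card_Un_disjoint)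
    moreover have "(P \<union> Q) \<inter> R = {}" "P \<inter> (Q \<union> R) = {}" using True by auto
    moreover have "(-1) ^ card P * (-1) ^ card P = (1 :: int)"
      by (simp flip: power_mult_distrib)
    ultimately show ?thesis using True
      by (simp add: inversions_Un_left inversions_Un_right power_add ac_simps)
  next
    case False
    then show ?thesis by auto
  qed
qed

end

definition gE :: "('n::{finite,linorder} ebasis, 'k::comm_ring_1) alg" where
  "gE = basis (GX True {})"

definition xE :: "'n::{finite,linorder} \<Rightarrow> ('n ebasis, 'k::comm_ring_1) alg" where
  "xE i = basis (GX False {i})"

definition xprod :: "('n::{finite,linorder} \<Rightarrow> 'a::ring_1) \<Rightarrow> 'n set \<Rightarrow> 'a" where
  "xprod X P = prod_list (map X (sorted_list_of_set P))"

text \<open>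
  \<open>E_lift G X\<close> is the linear map sending each basis element \<open>g\<^sup>a x\<^sub>P\<close> to \<open>G\<^sup>a X\<^sub>P\<close>, the product in
  \<open>X\<^sub>P\<close> being taken in increasing order. The facts \<open>E_relations\<close>, \<open>E_basis\<close> and
  \<open>E_lift_hom\<close> below say that the algebra is the one presented by the generators
  \<open>g, x\<^sub>i\<close> and the relations \<open>E_rel\<close>. The counit and the antipode are determined by
  \<open>E_comult\<close> and do not enter the notions above.
\<close>

definition E_lift ::
  "('b, 'k) alg \<Rightarrow> ('n \<Rightarrow> ('b, 'k) alg) \<Rightarrow> ('n::{finite,linorder} ebasis, 'k) alg \<Rightarrow>
   ('b::signed_basis, 'k::comm_ring_1) alg" where
  "E_lift G X u =
     (\<Sum>b\<in>UNIV. coeff_of u b *\<^sub>k (case b of GX a P \<Rightarrow> (if a then G else 1) * xprod X P))"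

definition E_rel :: "'a::ring_1 \<Rightarrow> ('n \<Rightarrow> 'a) \<Rightarrow> bool" where
  "E_rel G X \<longleftrightarrow> G * G = 1 \<and> (\<forall>i. X i * X i = 0) \<and> (\<forall>i. G * X i = - (X i * G)) \<and>
     (\<forall>i j. X i * X j = - (X j * X i))"

definition E_comult ::
  "('n::{finite,linorder} ebasis, 'k::comm_ring_1) alg \<Rightarrow> ('n ebasis \<times> 'n ebasis, 'k) alg" where
  "E_comult = E_lift (gE \<otimes>\<^sub>k gE) (\<lambda>i. xE i \<otimes>\<^sub>k 1 + gE \<otimes>\<^sub>k xE i)"

lemma xE_mult:
  "xE i * xE j = (if i = j then 0 else if j < i then - basis (GX False {i, j})
     else basis (GX False {i, j}))"
proof -
  have "inversions {i} {j} = (if j < i then 1 else 0)"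
  proof -
    have "{q \<in> {j}. q < i} = (if j < i then {j} else {})" by auto
    then show ?thesis by (simp add: inversions_singleton)
  qed
  then show ?thesis by (auto simp: xE_def basis_mult insert_commute)
qed

lemma E_relations: "E_rel gE (xE :: 'n::{finite,linorder} \<Rightarrow> ('n ebasis, 'k::comm_ring_1) alg)"
  unfolding E_rel_def
proof (intro conjI allI)
  show "gE * gE = (1 :: ('n ebasis, 'k) alg)"
    by (simp add: gE_def basis_mult basis_one[symmetric] sb_one_ebasis_def)
  fix i j :: 'n
  show "xE i * xE i = (0 :: ('n ebasis, 'k) alg)" by (simp add: xE_mult)
  show "gE * xE i = - (xE i * gE :: ('n ebasis, 'k) alg)"
    by (simp add: gE_def xE_def basis_mult)
  show "xE i * xE j = - (xE j * xE i :: ('n ebasis, 'k) alg)"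
    by (auto simp: xE_mult insert_commute)
qed

lemma xprod_empty [simp]: "xprod X {} = 1"
  by (simp add: xprod_def)

lemma xprod_insert_less:
  fixes P :: "'n::{finite,linorder} set"
  assumes "\<And>p. p \<in> P \<Longrightarrow> i < p"
  shows "xprod X (insert i P) = X i * xprod X P"
proof -
  have "i \<notin> P" using assms by auto
  moreover have "insort i (sorted_list_of_set P) = i # sorted_list_of_set P"
    using assms by (intro insort_is_Cons) (auto intro: less_imp_le)
  ultimately show ?thesis by (simp add: xprod_def)
qed

lemma xprod_xE: "xprod xE P = (basis (GX False P) :: ('n::{finite,linorder} ebasis, 'k::comm_ring_1) alg)"
proof (induction P rule: finite_linorder_min_induct[OF finite])
  case 1
  then show ?case by (simp add: basis_one[symmetric] sb_one_ebasis_def)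
next
  case (2 i P)
  then have *: "inversions {i} P = 0" "i \<notin> P"
    by (auto simp: inversions_singleton)
  have "xprod xE (insert i P) = (xE i * xprod xE P :: ('n ebasis, 'k) alg)"
    by (rule xprod_insert_less) (use 2 in auto)
  also have "\<dots> = basis (GX False {i}) * basis (GX False P)"
    by (simp only: 2(3)) (simp only: xE_def)
  finally show ?case using * by (simp add: basis_mult)
qed

lemma E_basis:
  "basis (GX a P) = (if a then gE else 1) * (xprod xE P :: ('n::{finite,linorder} ebasis, 'k::comm_ring_1) alg)"
  by (simp add: xprod_xE gE_def basis_mult)

lemma xprod_mult_left:
  fixes X :: "'n::{finite,linorder} \<Rightarrow> ('b::signed_basis, 'k::comm_ring_1) alg"
  assumes "E_rel G X"
  shows "X i * xprod X Q =
    (if i \<in> Q then 0 else (-1) ^ card {q \<in> Q. q < i} *\<^sub>k xprod X (insert i Q))"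
proof (induction Q rule: finite_linorder_min_induct[OF finite])
  case 1
  show ?case using xprod_insert_less[of "{}" i X] by simp
next
  case (2 j Q)
  have XX: "X a * X a = 0" "X a * X b = - (X b * X a)" for a b
    using assms unfolding E_rel_def by blast+
  have ins: "xprod X (insert j Q) = X j * xprod X Q"
    by (rule xprod_insert_less) (use 2 in auto)
  consider "i < j" | "i = j" | "j < i" by force
  then show ?case
  proof cases
    case 1
    then have less: "i < q" if "q \<in> insert j Q" for q
      using that 2(2) by (auto intro: less_trans)
    have "xprod X (insert i (insert j Q)) = X i * xprod X (insert j Q)"
      by (rule xprod_insert_less) (rule less)
    moreover have "{q \<in> insert j Q. q < i} = {}" "i \<notin> insert j Q"
      using less less_asym by blast+
    ultimately show ?thesis by (simp only: if_False card.empty power_0 scal_one)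
  next
    case 2
    have "X i * xprod X (insert j Q) = X j * X j * xprod X Q"
      by (simp only: ins 2 mult.assoc)
    then show ?thesis using 2 by (simp add: XX(1))
  next
    case 3
    have "X i * xprod X (insert j Q) = (X i * X j) * xprod X Q"
      by (simp only: ins mult.assoc)
    also have "\<dots> = - (X j * (X i * xprod X Q))"
      by (simp only: XX(2)[of i j] mult_minus_left mult.assoc)
    also have "\<dots> = (if i \<in> Q then 0 else
        - ((-1) ^ card {q \<in> Q. q < i} *\<^sub>k (X j * xprod X (insert i Q))))"
      by (simp add: 2(3))
    also have "X j * xprod X (insert i Q) = xprod X (insert i (insert j Q))"
      by (subst insert_commute, rule xprod_insert_less[symmetric]) (use 2 3 in auto)
    finally have eq: "X i * xprod X (insert j Q) = (if i \<in> Q then 0 else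
        - ((-1) ^ card {q \<in> Q. q < i} *\<^sub>k xprod X (insert i (insert j Q))))" .
    have "{q \<in> insert j Q. q < i} = insert j {q \<in> Q. q < i}" "j \<notin> Q"
      using 2 3 by auto
    then have "card {q \<in> insert j Q. q < i} = Suc (card {q \<in> Q. q < i})"
      by simp
    moreover have "i \<noteq> j" using 3 by simp
    ultimately show ?thesis by (simp add: eq)
  qed
qed

lemma xprod_mult:
  fixes X :: "'n::{finite,linorder} \<Rightarrow> ('b::signed_basis, 'k::comm_ring_1) alg"
  assumes "E_rel G X"
  shows "xprod X P * xprod X Q =
    (if P \<inter> Q = {} then (-1) ^ inversions P Q *\<^sub>k xprod X (P \<union> Q) else 0)"
proof (induction P rule: finite_linorder_min_induct[OF finite])
  case 1
  show ?case by simp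
next
  case (2 p P)
  have ins: "xprod X (insert p P) = X p * xprod X P"
    by (rule xprod_insert_less) (use 2 in auto)
  have less: "{q \<in> P \<union> Q. q < p} = {q \<in> Q. q < p}" and p: "p \<notin> P" using 2 by auto
  have inv: "inversions (insert p P) Q = card {q \<in> Q. q < p} + inversions P Q"
    using inversions_Un_left[of "{p}" P Q] p by (simp add: inversions_singleton)
  have eq: "xprod X (insert p P) * xprod X Q = X p * (xprod X P * xprod X Q)"
    by (simp only: ins mult.assoc)
  show ?case
  proof (cases "P \<inter> Q = {}")
    case True
    have "xprod X (insert p P) * xprod X Q =
        (-1) ^ inversions P Q *\<^sub>k (X p * xprod X (P \<union> Q))"
      by (simp only: eq 2(3) True simp_thms if_True mult_scal_right)
    also have "X p * xprod X (P \<union> Q) = (if p \<in> Q then 0 else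
        (-1) ^ card {q \<in> Q. q < p} *\<^sub>k xprod X (insert p P \<union> Q))"
      by (simp only: xprod_mult_left[OF assms] less) (simp add: p)
    finally show ?thesis
      by (cases "p \<in> Q") (simp_all add: True inv power_add mult.commute)
  next
    case False
    then have "insert p P \<inter> Q \<noteq> {}" by blast
    then show ?thesis by (simp only: eq 2(3) False if_False mult_zero_right)
  qed
qed

lemma xprod_mult_G:
  fixes X :: "'n::{finite,linorder} \<Rightarrow> ('b::signed_basis, 'k::comm_ring_1) alg"
  assumes "E_rel G X"
  shows "xprod X P * G = (-1) ^ card P *\<^sub>k (G * xprod X P)"
proof (induction P rule: finite_linorder_min_induct[OF finite])
  case 1
  show ?case by simp
next
  case (2 p P)
  have ins: "xprod X (insert p P) = X p * xprod X P"
    by (rule xprod_insert_less) (use 2 in auto)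
  have GX: "G * X p = - (X p * G)" using assms unfolding E_rel_def by blast
  have "xprod X (insert p P) * G = (-1) ^ card P *\<^sub>k (X p * G * xprod X P)"
    by (simp only: ins mult.assoc 2(3) mult_scal_right)
  moreover have "G * xprod X (insert p P) = - (X p * G * xprod X P)"
    by (simp only: ins GX mult_minus_left flip: mult.assoc)
  moreover have "p \<notin> P" using 2 by auto
  ultimately show ?case by simp
qed

lemma E_lift_add: "E_lift G X (u + v) = E_lift G X u + E_lift G X v"
  by (simp add: E_lift_def plus_alg.rep_eq scal_add_left sum.distrib)

lemma scal_sum_right: "c *\<^sub>k sum f S = (\<Sum>s\<in>S. c *\<^sub>k (f s :: ('b::signed_basis, 'k::comm_ring_1) alg))"
  by (induction S rule: infinite_finite_induct) (simp_all add: scal_add_right)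

lemma E_lift_scal: "E_lift G X (c *\<^sub>k u) = c *\<^sub>k E_lift G X u"
  by (simp add: E_lift_def scal.rep_eq scal_sum_right)

lemma E_lift_sum: "E_lift G X (sum f S) = (\<Sum>s\<in>S. E_lift G X (f s))"
  by (induction S rule: infinite_finite_induct)
    (simp_all add: E_lift_add, simp_all add: E_lift_def zero_alg.rep_eq)

lemma E_lift_basis: "E_lift G X (basis (GX a P)) = (if a then G else 1) * xprod X P"
proof -
  have "E_lift G X (basis (GX a P)) = (\<Sum>b\<in>UNIV. if b = GX a P
      then (case b of GX a P \<Rightarrow> (if a then G else 1) * xprod X P) else 0)"
    unfolding E_lift_def basis.rep_eq by (intro sum.cong refl) auto
  then show ?thesis by simp
qed

theorem E_lift_hom:
  fixes X :: "'n::{finite,linorder} \<Rightarrow> ('b::signed_basis, 'k::comm_ring_1) alg"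
  assumes rel: "E_rel G X"
  shows "E_lift G X 1 = 1"
    and "E_lift G X (u * v) = E_lift G X u * E_lift G X v"
    and "E_lift G X gE = G"
    and "E_lift G X (xE i) = X i"
proof -
  have GG: "G * G = 1"
    using rel unfolding E_rel_def by blast
  then have GGw: "G * (G * w) = w" for w
    by (simp flip: mult.assoc)
  show "E_lift G X 1 = 1"
  proof -
    have "(1 :: ('n ebasis, 'k) alg) = basis (GX False {})"
      by (simp add: sb_one_ebasis_def flip: basis_one)
    then show ?thesis using E_lift_basis[of G X False "{}"] by simp
  qed
  show "E_lift G X gE = G" by (simp add: gE_def E_lift_basis)
  show "E_lift G X (xE i) = X i"
    using xprod_insert_less[of "{}" i X] by (simp add: xE_def E_lift_basis)
  have *: "E_lift G X (basis x * basis y) = E_lift G X (basis x) * E_lift G X (basis y)" for x y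
  proof -
    obtain a P b Q where [simp]: "x = GX a P" "y = GX b Q" by (metis ebasis.exhaust)
    have "xprod X P * (G * xprod X Q) = (-1) ^ card P *\<^sub>k (G * (xprod X P * xprod X Q))"
      by (simp add: xprod_mult_G[OF rel] flip: mult.assoc)
    then show ?thesis
      by (auto simp: basis_mult E_lift_scal E_lift_basis mult.assoc xprod_mult[OF rel]
          xprod_mult_G[OF rel] power_add GG GGw)
  qed
  have "E_lift G X (u * v) = E_lift G X
      ((\<Sum>x\<in>UNIV. coeff_of u x *\<^sub>k basis x) * (\<Sum>y\<in>UNIV. coeff_of v y *\<^sub>k basis y))"
    by (simp flip: basis_expansion)
  also have "\<dots> = E_lift G X (\<Sum>x\<in>UNIV. coeff_of u x *\<^sub>k basis x) *
      E_lift G X (\<Sum>y\<in>UNIV. coeff_of v y *\<^sub>k basis y)"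
    by (simp add: sum_product E_lift_sum E_lift_scal * ac_simps)
  finally show "E_lift G X (u * v) = E_lift G X u * E_lift G X v"
    by (simp flip: basis_expansion)
qed

lemma tens_add_left: "(u + v) \<otimes>\<^sub>k w = u \<otimes>\<^sub>k w + v \<otimes>\<^sub>k w"
  for u v :: "('a::signed_basis, 'k::comm_ring_1) alg" and w :: "('b::signed_basis, 'k) alg"
  by (rule alg_eqI) (auto simp: tens.rep_eq plus_alg.rep_eq algebra_simps)

lemma tens_minus_left: "(- u) \<otimes>\<^sub>k w = - (u \<otimes>\<^sub>k w)"
  for u :: "('a::signed_basis, 'k::comm_ring_1) alg" and w :: "('b::signed_basis, 'k) alg"
  by (rule alg_eqI) (auto simp: tens.rep_eq uminus_alg.rep_eq)

lemma tens_minus_right: "u \<otimes>\<^sub>k (- w) = - (u \<otimes>\<^sub>k w)"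
  for u :: "('a::signed_basis, 'k::comm_ring_1) alg" and w :: "('b::signed_basis, 'k) alg"
  by (rule alg_eqI) (auto simp: tens.rep_eq uminus_alg.rep_eq)

lemma tens_zero [simp]:
  "0 \<otimes>\<^sub>k w = (0 :: ('a::signed_basis \<times> 'b::signed_basis, 'k::comm_ring_1) alg)"
  "u \<otimes>\<^sub>k 0 = (0 :: ('a \<times> 'b, 'k) alg)"
  by (rule alg_eqI, auto simp: tens.rep_eq zero_alg.rep_eq)+

lemma E_comult_rel:
  "E_rel (gE \<otimes>\<^sub>k gE)
     (\<lambda>i. xE i \<otimes>\<^sub>k 1 + gE \<otimes>\<^sub>k xE i :: ('n::{finite,linorder} ebasis \<times> 'n ebasis, 'k::comm_ring_1) alg)"
proof -
  have gg: "gE * gE = (1 :: ('n ebasis, 'k) alg)"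
    and xx: "xE i * xE i = (0 :: ('n ebasis, 'k) alg)"
    and gx: "gE * xE i = - (xE i * gE :: ('n ebasis, 'k) alg)"
    and xy: "xE i * xE j = - (xE j * xE i :: ('n ebasis, 'k) alg)" for i j :: 'n
    using E_relations[where 'n='n and 'k='k] unfolding E_rel_def by blast+
  show ?thesis
    unfolding E_rel_def
  proof (intro conjI allI)
    fix i j :: 'n
    let ?X = "\<lambda>i. xE i \<otimes>\<^sub>k 1 + gE \<otimes>\<^sub>k xE i :: ('n ebasis \<times> 'n ebasis, 'k) alg"
    show "(gE \<otimes>\<^sub>k gE) * (gE \<otimes>\<^sub>k gE) = (1 :: ('n ebasis \<times> 'n ebasis, 'k) alg)"
      by (simp add: tens_mult gg tens_one)
    show "(gE \<otimes>\<^sub>k gE) * ?X i = - (?X i * (gE \<otimes>\<^sub>k gE))"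
      by (simp add: algebra_simps tens_mult gg gx tens_minus_left tens_minus_right)
    show "?X i * ?X i = 0"
      by (simp add: algebra_simps tens_mult gg xx gx tens_minus_left)
    show "?X i * ?X j = - (?X j * ?X i)"
      by (simp add: algebra_simps tens_mult gg gx xy[of i j] tens_minus_left tens_minus_right)
  qed
qed

text \<open>So the comultiplication is an algebra map with the prescribed values on generators.\<close>

lemmas E_comult_hom = E_lift_hom[OF E_comult_rel, folded E_comult_def]

section \<open>The quasitriangular structures of E(n)\<close>

definition minor :: "'k::comm_ring_1 ^ 'n::{finite,linorder} ^ 'n::{finite,linorder} \<Rightarrow> 'n set \<Rightarrow> 'n set \<Rightarrow> 'k" where
  "minor A P F = det (mat (card P) (card F)
     (\<lambda>(i, j). vec_nth (vec_nth A (sorted_list_of_set P ! i)) (sorted_list_of_set F ! j)))"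

definition R_mat ::
  "'k::field ^ 'n::{finite,linorder} ^ 'n::{finite,linorder} \<Rightarrow> ('n ebasis \<times> 'n ebasis, 'k) alg" where
  "R_mat A =
     (1 / 2) *\<^sub>k (1 \<otimes>\<^sub>k 1 + 1 \<otimes>\<^sub>k gE + gE \<otimes>\<^sub>k 1 - gE \<otimes>\<^sub>k gE) +
     (1 / 2) *\<^sub>k (\<Sum>(P, F) | P \<noteq> {} \<and> F \<noteq> {} \<and> card F = card P.
       ((-1) ^ (card P * (card P - 1) div 2) * minor A P F) *\<^sub>k
         ((gE ^ card P * xprod xE F) \<otimes>\<^sub>k xprod xE P +
          (gE ^ card P * xprod xE F) \<otimes>\<^sub>k (gE * xprod xE P) +
          (gE ^ (card P + 1) * xprod xE F) \<otimes>\<^sub>k xprod xE P -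
          (gE ^ (card P + 1) * xprod xE F) \<otimes>\<^sub>k (gE * xprod xE P)))"

end

theory Submission
  imports Defs
begin

text \<open>
  Write \<open>R\<^sub>A = R\<^sub>0 (1 + N)\<close> with \<open>R\<^sub>0\<close> an involution in \<open>k[g] \<otimes> k[g]\<close> and \<open>N\<close> a combination of the
  elements \<open>g\<^bsup>|P|\<^esup> x\<^sub>F \<otimes> x\<^sub>P\<close> with \<open>|F| = |P| > 0\<close>; the determinants play no further role. Since \<open>\<chi>\<close>
  commutes with \<open>g \<otimes> g\<close>, its two legs have degrees of the same parity. Reading the axioms for
  \<open>(id \<otimes> \<Delta>)(\<chi>)\<close> and \<open>(\<Delta> \<otimes> id)(\<chi>)\<close> at \<open>1\<close> and \<open>g\<close> in the outer leg, and comparing terms of degree 0, gives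
  \<open>\<chi> \<in> span(x\<^sub>P, |P| even; g x\<^sub>P, |P| odd) \<otimes> span(x\<^sub>P)\<close>. For odd \<open>|P|\<close>, conjugation by \<open>R\<^sub>A\<close> sends
  \<open>g x\<^sub>P \<otimes> 1\<close> to \<open>g x\<^sub>P \<otimes> g\<close> and \<open>1 \<otimes> x\<^sub>P\<close> to \<open>g \<otimes> x\<^sub>P\<close>, so the axioms read at \<open>x\<^sub>i\<close> and \<open>g x\<^sub>i\<close> kill
  everything except \<open>\<chi> = \<Sum> b\<^sub>i\<^sub>j g x\<^sub>i \<otimes> x\<^sub>j\<close>. For such \<open>\<chi>\<close>, both being Cartier and being a coboundary amount
  to \<open>b\<close> being skew-symmetric; the cobounding element is \<open>\<alpha> = \<Sum> (b\<^sub>i\<^sub>j / 2) x\<^sub>i x\<^sub>j\<close>.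
\<close>

section \<open>Supports and slices\<close>

lemma coeff_mult_nonzeroE:
  fixes u v :: "('b::signed_basis, 'k::comm_ring_1) alg"
  assumes "coeff_of (u * v) c \<noteq> 0"
  obtains a b where "sb_mult a b = c" "sb_sign a b \<noteq> 0" "coeff_of u a \<noteq> 0" "coeff_of v b \<noteq> 0"
proof -
  obtain a where "(\<Sum>b\<in>UNIV. if sb_mult a b = c
      then of_int (sb_sign a b) * (coeff_of u a * coeff_of v b) else 0) \<noteq> 0"
    using assms unfolding times_alg.rep_eq
    by (rule sum.not_neutral_contains_not_neutral)
  then obtain b where "(if sb_mult a b = c
      then of_int (sb_sign a b) * (coeff_of u a * coeff_of v b) else 0) \<noteq> 0"
    by (rule sum.not_neutral_contains_not_neutral)
  then have "sb_mult a b = c" "of_int (sb_sign a b) * (coeff_of u a * coeff_of v b) \<noteq> 0"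
    by (auto split: if_splits)
  then show thesis using that[of a b] by fastforce
qed

text \<open>By bilinearity, a commutation rule with factor \<open>c\<close> only has to be checked
  on pairs of basis elements that actually occur in \<open>u\<close> and \<open>v\<close>.\<close>

lemma mult_swap_if_basis_swap:
  fixes u v :: "('b::signed_basis, 'k::comm_ring_1) alg"
  assumes "\<And>a b. coeff_of u a \<noteq> 0 \<Longrightarrow> coeff_of v b \<noteq> 0 \<Longrightarrow>
    basis a * basis b = c *\<^sub>k (basis b * basis a :: ('b, 'k) alg)"
  shows "u * v = c *\<^sub>k (v * u)"
proof -
  have *: "coeff_of u a *\<^sub>k basis a * (coeff_of v b *\<^sub>k basis b) =
      c *\<^sub>k (coeff_of v b *\<^sub>k basis b * (coeff_of u a *\<^sub>k basis a))" for a b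
    by (cases "coeff_of u a = 0 \<or> coeff_of v b = 0") (use assms[of a b] in \<open>auto simp: ac_simps\<close>)
  have "u * v = (\<Sum>a\<in>UNIV. coeff_of u a *\<^sub>k basis a) * (\<Sum>b\<in>UNIV. coeff_of v b *\<^sub>k basis b)"
    by (simp flip: basis_expansion)
  also have "\<dots> = c *\<^sub>k ((\<Sum>b\<in>UNIV. coeff_of v b *\<^sub>k basis b) * (\<Sum>a\<in>UNIV. coeff_of u a *\<^sub>k basis a))"
    unfolding sum_product scal_sum_right by (subst sum.swap) (simp only: *)
  finally show ?thesis by (simp flip: basis_expansion)
qed

lemma sum_mult_indicator:
  fixes f :: "'a::finite \<Rightarrow> 'k::comm_ring_1"
  shows "(\<Sum>x\<in>UNIV. f x * (if a = x then 1 else 0)) = f a"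
    and "(\<Sum>x\<in>UNIV. (if a = x then 1 else 0) * f x) = f a"
proof -
  have "(\<Sum>x\<in>UNIV. f x * (if a = x then 1 else 0)) = (\<Sum>x\<in>UNIV. if a = x then f x else 0)"
    by (rule sum.cong) auto
  then show "(\<Sum>x\<in>UNIV. f x * (if a = x then 1 else 0)) = f a" by simp
  then show "(\<Sum>x\<in>UNIV. (if a = x then 1 else 0) * f x) = f a" by (simp add: mult.commute)
qed

text \<open>Moving \<open>basis g\<close> across the expansion of \<open>u\<close> multiplies each
  coefficient by its swap factor, and the involution then cancels. Applied to
  \<open>g \<otimes> g\<close>, this turns commutation into a parity condition.\<close>

lemma coeff_of_commute_basis:
  fixes u :: "('b::signed_basis, 'k::comm_ring_1) alg"
  assumes comm: "basis g * u = u * basis g"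
    and inv: "basis g * basis g = (1 :: ('b, 'k) alg)"
    and swap: "\<And>a. basis g * basis a = s a *\<^sub>k (basis a * basis g :: ('b, 'k) alg)"
  shows "coeff_of u a = s a * coeff_of u a"
proof -
  let ?v = "\<Sum>a\<in>UNIV. (s a * coeff_of u a) *\<^sub>k basis a :: ('b, 'k) alg"
  have "u * basis g = basis g * (\<Sum>a\<in>UNIV. coeff_of u a *\<^sub>k basis a)"
    by (simp add: comm flip: basis_expansion)
  also have "\<dots> = ?v * basis g"
    by (simp add: sum_distrib_left sum_distrib_right swap mult.commute)
  finally have "u * (basis g * basis g) = ?v * (basis g * basis g)"
    by (simp only: flip: mult.assoc)
  then have "u = ?v" by (simp only: inv mult_1_right)
  then have "coeff_of u a = coeff_of ?v a" by simp
  then show ?thesis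
    by (simp add: coeff_of_sum scal.rep_eq basis.rep_eq sum_mult_indicator)
qed

text \<open>Slices contract one leg with a dual basis functional, so \<open>u\<close> is the sum of
  \<open>basis a \<otimes>\<^sub>k left_slice a u\<close>. They reduce identities in the triple
  tensor product to identities in the double one.\<close>

lift_definition left_slice :: "'a \<Rightarrow> ('a \<times> 'b, 'k) alg \<Rightarrow> ('b, 'k) alg"
  is "\<lambda>a u b. u (a, b)" .

lift_definition right_slice :: "'b \<Rightarrow> ('a \<times> 'b, 'k) alg \<Rightarrow> ('a, 'k) alg"
  is "\<lambda>b u a. u (a, b)" .

section \<open>The coproduct axioms in coordinates\<close>

lemma reassoc_mult: "reassoc (u * v) = reassoc u * reassoc v"
  for u v :: "(('a::signed_basis \<times> 'b::signed_basis) \<times> 'c::signed_basis, 'k::comm_ring_1) alg"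
  by (rule alg_eqI)
    (auto simp: reassoc.rep_eq times_alg.rep_eq sum_UNIV_prod sb_mult_prod_def sb_sign_prod_def
      mult.assoc intro!: sum.cong)

lemma reassoc_one:
  "reassoc 1 = (1 :: ('a::signed_basis \<times> 'b::signed_basis \<times> 'c::signed_basis, 'k::comm_ring_1) alg)"
  by (rule alg_eqI) (auto simp: reassoc.rep_eq one_alg.rep_eq sb_one_prod_def split: if_splits)

lemma leg12_mult: "leg12 (u * v) = leg12 u * leg12 v"
  by (simp add: leg12_def tens_mult flip: reassoc_mult)

lemma leg12_one: "leg12 1 = 1"
  by (simp add: leg12_def tens_one reassoc_one)

lemma leg23_mult: "leg23 (u * v) = leg23 u * leg23 v"
  by (simp add: leg23_def tens_mult)

lemma leg23_one: "leg23 1 = 1"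
  by (simp add: leg23_def tens_one)

lemma coeff_of_leg12:
  "coeff_of (leg12 T) (a, b, c) = (if c = sb_one then coeff_of T (a, b) else 0)"
  by (simp add: leg12_def reassoc.rep_eq tens.rep_eq one_alg.rep_eq)

lemma coeff_of_leg23:
  "coeff_of (leg23 T) (a, b, c) = (if a = sb_one then coeff_of T (b, c) else 0)"
  by (simp add: leg23_def tens.rep_eq one_alg.rep_eq)

lemma coeff_of_leg13:
  "coeff_of (leg13 T) (a, b, c) = (if b = sb_one then coeff_of T (a, c) else 0)"
proof -
  have "coeff_of (leg13 T) (a, b, c) =
      (\<Sum>a'\<in>UNIV. if a' = a then \<Sum>c'\<in>UNIV. if c' = c
         then (if b = sb_one then coeff_of T (a', c') else 0) else 0 else 0)"
    unfolding leg13_def coeff_of_sum sum_UNIV_prod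
    by (rule sum.cong[OF refl])
      (auto simp: scal.rep_eq tens.rep_eq basis.rep_eq one_alg.rep_eq if_distrib cong: if_cong
        intro!: sum.neutral)
  then show ?thesis by simp
qed

text \<open>Grouping by the last leg leaves elements of the form \<open>r \<otimes> 1\<close> on the
  first two legs, which are the only ones that \<open>leg12 R\<close> touches.\<close>

lemma leg13_right_slices:
  "leg13 T = (\<Sum>c\<in>UNIV. reassoc ((right_slice c T \<otimes>\<^sub>k 1) \<otimes>\<^sub>k basis c))"
proof (rule alg_eqI, clarify)
  fix a b c
  show "coeff_of (leg13 T) (a, b, c) =
    coeff_of (\<Sum>c\<in>UNIV. reassoc ((right_slice c T \<otimes>\<^sub>k 1) \<otimes>\<^sub>k basis c)) (a, b, c)"
    by (simp add: coeff_of_leg13 coeff_of_sum reassoc.rep_eq tens.rep_eq basis.rep_eq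
        one_alg.rep_eq right_slice.rep_eq sum_mult_indicator)
qed

lemma leg13_left_slices:
  "leg13 T = (\<Sum>a\<in>UNIV. basis a \<otimes>\<^sub>k 1 \<otimes>\<^sub>k left_slice a T)"
proof (rule alg_eqI, clarify)
  fix a b c
  show "coeff_of (leg13 T) (a, b, c) =
    coeff_of (\<Sum>a\<in>UNIV. basis a \<otimes>\<^sub>k 1 \<otimes>\<^sub>k left_slice a T) (a, b, c)"
    by (simp add: coeff_of_leg13 coeff_of_sum tens.rep_eq basis.rep_eq
        one_alg.rep_eq left_slice.rep_eq sum_mult_indicator)
qed

lemma coeff_of_conj_leg12:
  assumes "R * S = 1" "S * R = 1"
  shows "coeff_of (ring_inv (leg12 R) * leg13 T * leg12 R) (a, b, c) =
    coeff_of (S * (right_slice c T \<otimes>\<^sub>k 1) * R) (a, b)"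
proof -
  have "ring_inv (leg12 R) = leg12 S"
    by (rule ring_inv_eq) (simp_all add: assms leg12_one flip: leg12_mult)
  then have "ring_inv (leg12 R) * leg13 T * leg12 R =
      (\<Sum>d\<in>UNIV. reassoc ((S * (right_slice d T \<otimes>\<^sub>k 1) * R) \<otimes>\<^sub>k basis d))"
    by (simp add: leg13_right_slices leg12_def sum_distrib_left sum_distrib_right tens_mult
        flip: reassoc_mult)
  then show ?thesis
    by (simp add: coeff_of_sum reassoc.rep_eq tens.rep_eq basis.rep_eq sum_mult_indicator)
qed

lemma coeff_of_conj_leg23:
  assumes "R * S = 1" "S * R = 1"
  shows "coeff_of (ring_inv (leg23 R) * leg13 T * leg23 R) (a, b, c) =
    coeff_of (S * (1 \<otimes>\<^sub>k left_slice a T) * R) (b, c)"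
proof -
  have "ring_inv (leg23 R) = leg23 S"
    by (rule ring_inv_eq) (simp_all add: assms leg23_one flip: leg23_mult)
  then have "ring_inv (leg23 R) * leg13 T * leg23 R =
      (\<Sum>d\<in>UNIV. basis d \<otimes>\<^sub>k (S * (1 \<otimes>\<^sub>k left_slice d T) * R))"
    by (simp add: leg13_left_slices leg23_def sum_distrib_left sum_distrib_right tens_mult)
  then show ?thesis
    by (simp add: coeff_of_sum tens.rep_eq basis.rep_eq sum_mult_indicator)
qed

text \<open>The premise is linearity of \<open>\<Delta>\<close> in basis form:
  \<open>\<Delta>\<close> is an arbitrary function here, and \<open>id_tens\<close> evaluates it on
  basis elements only.\<close>

lemma coeff_of_id_tens:
  assumes "\<And>u. \<Delta> u = (\<Sum>w\<in>UNIV. coeff_of u w *\<^sub>k \<Delta> (basis w))"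
  shows "coeff_of (id_tens \<Delta> T) (a, b, c) = coeff_of (\<Delta> (left_slice a T)) (b, c)"
proof -
  have "coeff_of (id_tens \<Delta> T) (a, b, c) = (\<Sum>a'\<in>UNIV. if a' = a then
      \<Sum>w\<in>UNIV. coeff_of T (a', w) * coeff_of (\<Delta> (basis w)) (b, c) else 0)"
    unfolding id_tens_def coeff_of_sum sum_UNIV_prod
    by (rule sum.cong[OF refl]) (auto simp: scal.rep_eq tens.rep_eq basis.rep_eq intro!: sum.neutral)
  also have "\<dots> = coeff_of (\<Delta> (left_slice a T)) (b, c)"
    by (subst (2) assms) (simp add: coeff_of_sum scal.rep_eq left_slice.rep_eq)
  finally show ?thesis .
qed

lemma coeff_of_tens_id:
  assumes "\<And>u. \<Delta> u = (\<Sum>w\<in>UNIV. coeff_of u w *\<^sub>k \<Delta> (basis w))"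
  shows "coeff_of (tens_id \<Delta> T) (a, b, c) = coeff_of (\<Delta> (right_slice c T)) (a, b)"
proof -
  have "coeff_of (tens_id \<Delta> T) (a, b, c) = (\<Sum>w\<in>UNIV. \<Sum>c'\<in>UNIV. if c' = c then
      coeff_of T (w, c') * coeff_of (\<Delta> (basis w)) (a, b) else 0)"
    unfolding tens_id_def coeff_of_sum sum_UNIV_prod
    by (intro sum.cong[OF refl]) (auto simp: scal.rep_eq tens.rep_eq basis.rep_eq reassoc.rep_eq)
  also have "\<dots> = coeff_of (\<Delta> (right_slice c T)) (a, b)"
    by (subst (2) assms) (simp add: coeff_of_sum scal.rep_eq right_slice.rep_eq)
  finally show ?thesis .
qed

text \<open>Both coproduct axioms are read at the coordinate \<open>(a, b, c)\<close>. The support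
  of \<chi> is later determined entirely by choosing suitable triples in these two
  equations.\<close>

lemma infinitesimal_R_matrix_coeffs:
  assumes "infinitesimal_R_matrix \<Delta> R \<chi>"
    and inv: "R * S = 1" "S * R = 1"
    and lin: "\<And>u. \<Delta> u = (\<Sum>w\<in>UNIV. coeff_of u w *\<^sub>k \<Delta> (basis w))"
  shows "coeff_of (\<Delta> (left_slice a \<chi>)) (b, c) =
      (if c = sb_one then coeff_of \<chi> (a, b) else 0) +
      coeff_of (S * (right_slice c \<chi> \<otimes>\<^sub>k 1) * R) (a, b)"
    and "coeff_of (\<Delta> (right_slice c \<chi>)) (a, b) =
      (if a = sb_one then coeff_of \<chi> (b, c) else 0) +
      coeff_of (S * (1 \<otimes>\<^sub>k left_slice a \<chi>) * R) (b, c)"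
proof -
  have *: "id_tens \<Delta> \<chi> = leg12 \<chi> + ring_inv (leg12 R) * leg13 \<chi> * leg12 R"
    "tens_id \<Delta> \<chi> = leg23 \<chi> + ring_inv (leg23 R) * leg13 \<chi> * leg23 R"
    using assms(1) unfolding infinitesimal_R_matrix_def by blast+
  show "coeff_of (\<Delta> (left_slice a \<chi>)) (b, c) =
      (if c = sb_one then coeff_of \<chi> (a, b) else 0) +
      coeff_of (S * (right_slice c \<chi> \<otimes>\<^sub>k 1) * R) (a, b)"
    using arg_cong[OF *(1), of "\<lambda>u. coeff_of u (a, b, c)"]
    by (simp only: coeff_of_id_tens[OF lin] plus_alg.rep_eq coeff_of_leg12 coeff_of_conj_leg12[OF inv])
  show "coeff_of (\<Delta> (right_slice c \<chi>)) (a, b) =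
      (if a = sb_one then coeff_of \<chi> (b, c) else 0) +
      coeff_of (S * (1 \<otimes>\<^sub>k left_slice a \<chi>) * R) (b, c)"
    using arg_cong[OF *(2), of "\<lambda>u. coeff_of u (a, b, c)"]
    by (simp only: coeff_of_tens_id[OF lin] plus_alg.rep_eq coeff_of_leg23 coeff_of_conj_leg23[OF inv])
qed

lemma one_add_nilpotent_invertible:
  fixes x :: "'a::ring_1"
  assumes "x ^ m = 0"
  obtains y where "(1 + x) * y = 1" "y * (1 + x) = 1"
proof -
  \<comment> \<open>The inverse is the geometric series in \<open>- x\<close>, truncated where the
    powers vanish.\<close>
  let ?y = "\<lambda>m. \<Sum>i<m. (- x) ^ i"
  have *: "(1 + x) * ?y m = 1 - (- x) ^ m \<and> ?y m * (1 + x) = 1 - (- x) ^ m" for m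
  proof (induction m)
    case (Suc m)
    have "(- x) ^ m * x = x * (- x) ^ m"
      using power_commutes[of "- x" m] by simp
    with Suc show ?case by (simp add: algebra_simps)
  qed simp
  have "(- x) ^ m = 0" using assms by (simp add: power_minus[of x])
  then show thesis using that[of "?y m"] * by simp
qed

section \<open>Commutation and comultiplication in E(n)\<close>

text \<open>Each pair in \<open>P \<times> Q\<close> is an inversion in exactly one of the two
  orders, as disjointness excludes equality.\<close>

lemma inversions_add_swap:
  fixes P Q :: "'n::{finite,linorder} set"
  assumes "P \<inter> Q = {}"
  shows "inversions P Q + inversions Q P = card P * card Q"
proof -
  have "inversions Q P = card {(p, q). p \<in> P \<and> q \<in> Q \<and> p < q}"
  proof -
    have "{(q, p). q \<in> Q \<and> p \<in> P \<and> p < q} = prod.swap ` {(p, q). p \<in> P \<and> q \<in> Q \<and> p < q}"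
      by auto
    then show ?thesis by (simp add: inversions_def card_image)
  qed
  moreover have "P \<times> Q = {(p, q). p \<in> P \<and> q \<in> Q \<and> q < p} \<union> {(p, q). p \<in> P \<and> q \<in> Q \<and> p < q}"
    using assms by auto
  moreover have "{(p, q). p \<in> P \<and> q \<in> Q \<and> q < p} \<inter> {(p, q). p \<in> P \<and> q \<in> Q \<and> p < q} = {}"
    by auto
  ultimately show ?thesis
    by (simp only: inversions_def card_cartesian_product[symmetric])
      (simp only: card_Un_disjoint finite)
qed

text \<open>The exponent counts \<open>g\<close> passing each monomial and the monomials passing
  each other. If \<open>P\<close> and \<open>Q\<close> meet, both products are 0.\<close>

lemma ebasis_commute:
  "basis (GX a P) * basis (GX b Q) =
   (-1) ^ ((if b then card P else 0) + (if a then card Q else 0) + card P * card Q) *\<^sub>k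
     (basis (GX b Q) * basis (GX a P) :: ('n::{finite,linorder} ebasis, 'k::comm_ring_1) alg)"
proof (cases "P \<inter> Q = {}")
  case True
  then have eq: "card P * card Q = inversions P Q + inversions Q P"
    by (simp add: inversions_add_swap)
  have sq: "(-1) ^ m * ((-1) ^ m * z) = (z :: 'k)" for m z
    by (simp flip: mult.assoc power_mult_distrib)
  have "Q \<inter> P = {}" "(a \<noteq> b) = (b \<noteq> a)" "P \<union> Q = Q \<union> P" using True by auto
  then show ?thesis using True
    by (simp add: basis_mult eq power_add ac_simps sq)
next
  case False
  then have "Q \<inter> P \<noteq> {}" by blast
  then show ?thesis using False by (simp add: basis_mult)
qed

lemma tens_scal: "(c *\<^sub>k u) \<otimes>\<^sub>k (d *\<^sub>k v) = (c * d) *\<^sub>k (u \<otimes>\<^sub>k v)"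
  by (rule alg_eqI) (auto simp: tens.rep_eq scal.rep_eq)

lemma ebasis_tens_commute:
  fixes P Q P' Q' :: "'n::{finite,linorder} set" and a b a' b' :: bool
  defines "m \<equiv> (if b then card P else 0) + (if a then card Q else 0) + card P * card Q"
    and "m' \<equiv> (if b' then card P' else 0) + (if a' then card Q' else 0) + card P' * card Q'"
  shows "basis (GX a P, GX a' P') * basis (GX b Q, GX b' Q') =
    (-1) ^ (m + m') *\<^sub>k
      (basis (GX b Q, GX b' Q') * basis (GX a P, GX a' P') :: (_, 'k::comm_ring_1) alg)"
proof -
  have "basis (GX a P, GX a' P') * basis (GX b Q, GX b' Q') =
      (basis (GX a P) * basis (GX b Q)) \<otimes>\<^sub>k (basis (GX a' P') * basis (GX b' Q') :: (_, 'k) alg)"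
    by (simp add: tens_mult flip: tens_basis)
  also have "\<dots> = (-1) ^ (m + m') *\<^sub>k
      ((basis (GX b Q) * basis (GX a P)) \<otimes>\<^sub>k (basis (GX b' Q') * basis (GX a' P')))"
    by (simp only: ebasis_commute[of a P b Q] ebasis_commute[of a' P' b' Q'] tens_scal power_add
        m_def m'_def)
  finally show ?thesis by (simp add: tens_mult flip: tens_basis)
qed

section \<open>The comultiplication on monomials\<close>

lemma E_lift_expansion: "E_lift G X u = (\<Sum>w\<in>UNIV. coeff_of u w *\<^sub>k E_lift G X (basis w))"
  by (subst (1) basis_expansion[of u]) (simp add: E_lift_sum E_lift_scal)

lemma E_comult_expansion: "E_comult u = (\<Sum>w\<in>UNIV. coeff_of u w *\<^sub>k E_comult (basis w))"
  unfolding E_comult_def by (rule E_lift_expansion)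

lemma basis_GX_one: "basis (GX False {}) = (1 :: ('n::{finite,linorder} ebasis, 'k::comm_ring_1) alg)"
  by (simp add: sb_one_ebasis_def flip: basis_one)

text \<open>Expanding the product means choosing the set \<open>Q\<close> of indices that go to the
  right leg; each of them leaves a \<open>g\<close> on the left. The induction peels off the least
  index.\<close>

lemma xprod_comult:
  "xprod (\<lambda>i. xE i \<otimes>\<^sub>k 1 + gE \<otimes>\<^sub>k xE i) P =
    (\<Sum>Q\<in>Pow P. (-1) ^ inversions Q (P - Q) *\<^sub>k
      (basis (GX (odd (card Q)) (P - Q), GX False Q) ::
        ('n::{finite,linorder} ebasis \<times> 'n ebasis, 'k::comm_ring_1) alg))"
proof (induction P rule: finite_linorder_min_induct[OF finite])
  case 1
  show ?case by (simp add: basis_GX_one tens_one flip: tens_basis)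
next
  case (2 i P)
  let ?t = "\<lambda>P Q. (-1) ^ inversions Q (P - Q) *\<^sub>k
      (basis (GX (odd (card Q)) (P - Q), GX False Q) :: ('n ebasis \<times> 'n ebasis, 'k) alg)"
  have iP: "i \<notin> P" and less: "\<And>q. q \<in> P \<Longrightarrow> i < q" using 2 by auto
  have inv0: "inversions {i} Q = 0" if "Q \<subseteq> P" for Q
  proof -
    have "{q \<in> Q. q < i} = {}" using that less less_asym by blast
    then show ?thesis by (simp add: inversions_singleton)
  qed
  have inv1: "inversions Q {i} = card Q" if "Q \<subseteq> P" for Q
  proof -
    have "i \<notin> Q" using that iP by auto
    then show ?thesis using inversions_add_swap[of Q "{i}"] inv0[OF that] by simp
  qed
  have gens: "xE i \<otimes>\<^sub>k 1 = (basis (GX False {i}, GX False {}) :: ('n ebasis \<times> 'n ebasis, 'k) alg)"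
    "gE \<otimes>\<^sub>k xE i = (basis (GX True {}, GX False {i}) :: ('n ebasis \<times> 'n ebasis, 'k) alg)"
    by (simp_all add: xE_def gE_def basis_GX_one flip: tens_basis)
  \<comment> \<open>Here \<open>i\<close> stays on the left. Moving \<open>x_i\<close> past the
    power of \<open>g\<close> costs \<open>(-1) ^ card Q\<close>, which matches the new inversions:
    \<open>i\<close> lies below every element of \<open>Q\<close>.\<close>
  have x1: "(xE i \<otimes>\<^sub>k 1) * ?t P Q = ?t (insert i P) Q" if "Q \<subseteq> P" for Q
  proof -
    have "i \<notin> Q" using that iP by auto
    then have "insert i P - Q = {i} \<union> (P - Q)" by auto
    moreover have "inversions Q ({i} \<union> (P - Q)) = card Q + inversions Q (P - Q)"
      using inversions_Un_right[of "{i}" "P - Q" Q] iP inv1[OF that] by simp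
    moreover have "inversions {i} (P - Q) = 0" by (rule inv0) auto
    ultimately show ?thesis using iP
      by (simp add: gens basis_mult sb_mult_prod_def sb_sign_prod_def power_add)
  qed
  \<comment> \<open>Here \<open>i\<close> goes to the right. Being least and already in front, it
    creates no sign.\<close>
  have x2: "(gE \<otimes>\<^sub>k xE i) * ?t P Q = ?t (insert i P) (insert i Q)" if "Q \<subseteq> P" for Q
  proof -
    have iQ: "i \<notin> Q" using that iP by auto
    have "insert i P - insert i Q = P - Q" using iP by auto
    moreover have "inversions (insert i Q) (P - Q) = inversions Q (P - Q)"
      using inversions_Un_left[of "{i}" Q "P - Q"] iQ inv0[of "P - Q"] by simp
    moreover have "inversions {i} Q = 0" by (rule inv0[OF that])
    ultimately show ?thesis using iQ
      by (simp add: gens basis_mult sb_mult_prod_def sb_sign_prod_def)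
  qed
  have "(\<Sum>Q\<in>Pow (insert i P). ?t (insert i P) Q) =
      (\<Sum>Q\<in>Pow P. ?t (insert i P) Q) + (\<Sum>Q\<in>insert i ` Pow P. ?t (insert i P) Q)"
    unfolding Pow_insert by (rule sum.union_disjoint) (use iP in auto)
  also have "(\<Sum>Q\<in>insert i ` Pow P. ?t (insert i P) Q) = (\<Sum>Q\<in>Pow P. ?t (insert i P) (insert i Q))"
    by (subst sum.reindex) (use iP in \<open>auto simp: inj_on_def o_def\<close>)
  also have "(\<Sum>Q\<in>Pow P. ?t (insert i P) Q) + \<dots> =
      (xE i \<otimes>\<^sub>k 1 + gE \<otimes>\<^sub>k xE i) * (\<Sum>Q\<in>Pow P. ?t P Q)"
    unfolding distrib_right sum_distrib_left sum.distrib
    by (intro arg_cong2[where f = "(+)"] sum.cong refl) (simp_all only: Pow_iff x1 x2)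
  also have "\<dots> = xprod (\<lambda>i. xE i \<otimes>\<^sub>k 1 + gE \<otimes>\<^sub>k xE i) (insert i P)"
    by (simp only: xprod_insert_less[OF less] 2(3))
  finally show ?case ..
qed

lemma E_comult_basis:
  "E_comult (basis (GX a P)) = (\<Sum>Q\<in>Pow P. (-1) ^ inversions Q (P - Q) *\<^sub>k
    (basis (GX (a \<noteq> odd (card Q)) (P - Q), GX a Q) ::
      ('n::{finite,linorder} ebasis \<times> 'n ebasis, 'k::comm_ring_1) alg))"
proof -
  have "(gE \<otimes>\<^sub>k gE) * basis (GX b Q, GX c S) = (basis (GX (\<not> b) Q, GX (\<not> c) S) :: (_, 'k) alg)"
    for b c and Q S :: "'n set"
    by (simp add: gE_def tens_basis basis_mult sb_mult_prod_def sb_sign_prod_def)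
  then show ?thesis
    by (cases a) (simp_all add: E_comult_def E_lift_basis xprod_comult sum_distrib_left)
qed

text \<open>A coordinate of the coproduct sees one coefficient of \<open>u\<close> only: the two
  index sets must be disjoint with union the original set, and the exponent of \<open>g\<close> on
  the left is forced.\<close>

lemma coeff_of_E_comult:
  fixes u :: "('n::{finite,linorder} ebasis, 'k::comm_ring_1) alg"
  shows "coeff_of (E_comult u) (GX b S, GX c Q) =
    (if b = (c \<noteq> odd (card Q)) \<and> S \<inter> Q = {}
     then (-1) ^ inversions Q S * coeff_of u (GX c (S \<union> Q)) else 0)"
proof -
  have *: "coeff_of (E_comult (basis (GX a P) :: ('n ebasis, 'k) alg)) (GX b S, GX c Q) =
    (if GX c (S \<union> Q) = GX a P
     then (if b = (c \<noteq> odd (card Q)) \<and> S \<inter> Q = {} then (-1) ^ inversions Q S else 0) else (0 :: 'k))"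
    for a P
  proof -
    have "coeff_of (E_comult (basis (GX a P) :: ('n ebasis, 'k) alg)) (GX b S, GX c Q) =
      (\<Sum>Q'\<in>Pow P. if Q' = Q then (if b = (c \<noteq> odd (card Q)) \<and> S = P - Q \<and> c = a
        then (-1) ^ inversions Q S else 0) else (0 :: 'k))"
      unfolding E_comult_basis coeff_of_sum
      by (intro sum.cong refl) (auto simp: scal.rep_eq basis.rep_eq)
    also have "\<dots> = (if Q \<subseteq> P then (if b = (c \<noteq> odd (card Q)) \<and> S = P - Q \<and> c = a
        then (-1) ^ inversions Q S else 0) else 0)"
      by simp
    also have "\<dots> = (if GX c (S \<union> Q) = GX a P
       then (if b = (c \<noteq> odd (card Q)) \<and> S \<inter> Q = {} then (-1) ^ inversions Q S else 0) else (0 :: 'k))"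
    proof (cases "Q \<subseteq> P \<and> S = P - Q")
      case True
      then have "S \<union> Q = P" "S \<inter> Q = {}" by auto
      then show ?thesis using True by simp
    next
      case False
      then have "\<not> (S \<union> Q = P \<and> S \<inter> Q = {})" by blast
      then show ?thesis using False by (cases "S \<union> Q = P") auto
    qed
    finally show ?thesis .
  qed
  let ?s = "if b = (c \<noteq> odd (card Q)) \<and> S \<inter> Q = {} then (-1) ^ inversions Q S else (0 :: 'k)"
  have "coeff_of (E_comult u) (GX b S, GX c Q) =
    (\<Sum>w\<in>UNIV. coeff_of u w * (if GX c (S \<union> Q) = w then ?s else 0))"
  proof -
    have "coeff_of (E_comult (basis w :: ('n ebasis, 'k) alg)) (GX b S, GX c Q) = (if GX c (S \<union> Q) = w then ?s else 0)" for w
      by (cases w) (simp only: *)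
    then show ?thesis
      by (subst E_comult_expansion) (simp only: coeff_of_sum scal.rep_eq)
  qed
  also have "\<dots> = (\<Sum>w\<in>UNIV. if GX c (S \<union> Q) = w then coeff_of u w * ?s else 0)"
    by (intro sum.cong refl) auto
  also have "\<dots> = coeff_of u (GX c (S \<union> Q)) * ?s" by simp
  also have "x * (if B then y else 0) = (if B then y * x else 0)" for B and x y :: 'k by simp
  finally show ?thesis .
qed

section \<open>Conjugation by the universal R-matrix\<close>

text \<open>This is the R-matrix of the group algebra of order 2. With \<open>e = (1 + g)/2\<close>
  and \<open>f = (1 - g)/2\<close> it equals \<open>e \<otimes> 1 + f \<otimes> g\<close>, which
  acts as -1 on \<open>f \<otimes> f\<close> and as 1 on the other three products of
  idempotents.\<close>

definition R_sign :: "('n::{finite,linorder} ebasis \<times> 'n ebasis, 'k::field) alg" where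
  "R_sign = (1 / 2) *\<^sub>k (1 \<otimes>\<^sub>k 1 + 1 \<otimes>\<^sub>k gE + gE \<otimes>\<^sub>k 1 - gE \<otimes>\<^sub>k gE)"

definition R_nil ::
  "'k::field ^ 'n::{finite,linorder} ^ 'n::{finite,linorder} \<Rightarrow> ('n ebasis \<times> 'n ebasis, 'k) alg" where
  "R_nil A = (\<Sum>(P, F) | P \<noteq> {} \<and> F \<noteq> {} \<and> card F = card P.
     ((-1) ^ (card P * (card P - 1) div 2) * minor A P F) *\<^sub>k
       basis (GX (odd (card P)) F, GX False P))"

lemma gE_gE [simp]: "gE * gE = (1 :: ('n::{finite,linorder} ebasis, 'k::comm_ring_1) alg)"
  using E_relations unfolding E_rel_def by blast

lemma gE_power: "gE ^ m = (if odd m then gE else 1 :: ('n::{finite,linorder} ebasis, 'k::comm_ring_1) alg)"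
  by (induction m) auto

lemma tens_add_right: "u \<otimes>\<^sub>k (v + w) = u \<otimes>\<^sub>k v + u \<otimes>\<^sub>k w"
  for u :: "('a::signed_basis, 'k::comm_ring_1) alg" and v w :: "('b::signed_basis, 'k) alg"
  by (rule alg_eqI) (auto simp: tens.rep_eq plus_alg.rep_eq algebra_simps)

text \<open>Each four-term bracket of \<open>R_mat\<close> is twice \<open>R_sign\<close> times the
  monomial \<open>g^|P| x_F \<otimes> x_P\<close>.\<close>

lemma R_mat_factorization:
  fixes A :: "'k::field ^ 'n::{finite,linorder} ^ 'n::{finite,linorder}"
  shows "R_mat A = R_sign * (1 + R_nil A)"
proof -
  have *: "R_sign * basis (GX (odd (card P)) F, GX False P) = (1 / 2) *\<^sub>k
      ((gE ^ card P * xprod xE F) \<otimes>\<^sub>k xprod xE P +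
       (gE ^ card P * xprod xE F) \<otimes>\<^sub>k (gE * xprod xE P) +
       (gE ^ (card P + 1) * xprod xE F) \<otimes>\<^sub>k xprod xE P -
       (gE ^ (card P + 1) * xprod xE F) \<otimes>\<^sub>k (gE * xprod xE P) :: (_, 'k) alg)"
    for P F :: "'n set"
  proof -
    have "basis (GX (odd (card P)) F, GX False P) =
        (gE ^ card P * xprod xE F) \<otimes>\<^sub>k (xprod xE P :: (_, 'k) alg)"
      by (simp add: E_basis gE_power flip: tens_basis)
    then show ?thesis
      by (simp add: R_sign_def algebra_simps tens_mult)
  qed
  have "R_sign * R_nil A = (1 / 2) *\<^sub>k (\<Sum>(P, F) | P \<noteq> {} \<and> F \<noteq> {} \<and> card F = card P.
       ((-1) ^ (card P * (card P - 1) div 2) * minor A P F) *\<^sub>k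
         ((gE ^ card P * xprod xE F) \<otimes>\<^sub>k xprod xE P +
          (gE ^ card P * xprod xE F) \<otimes>\<^sub>k (gE * xprod xE P) +
          (gE ^ (card P + 1) * xprod xE F) \<otimes>\<^sub>k xprod xE P -
          (gE ^ (card P + 1) * xprod xE F) \<otimes>\<^sub>k (gE * xprod xE P)))"
    unfolding R_nil_def sum_distrib_left scal_sum_right
    by (intro sum.cong refl) (clarify, simp only: mult_scal_right *, simp only: scal_scal mult.commute)
  then show ?thesis unfolding R_mat_def by (simp add: distrib_left R_sign_def)
qed

lemma coeff_of_R_nil_nonzeroE:
  assumes "coeff_of (R_nil A) (p, q) \<noteq> 0"
  obtains P F where "P \<noteq> {}" "F \<noteq> {}" "card F = card P" "p = GX (odd (card P)) F" "q = GX False P"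
proof -
  obtain x where "x \<in> {(P, F). P \<noteq> {} \<and> F \<noteq> {} \<and> card F = card P}"
    "coeff_of (case x of (P, F) \<Rightarrow> ((-1) ^ (card P * (card P - 1) div 2) * minor A P F) *\<^sub>k
       basis (GX (odd (card P)) F, GX False P)) (p, q) \<noteq> 0"
    using assms unfolding R_nil_def coeff_of_sum by (rule sum.not_neutral_contains_not_neutral)
  then obtain P F where PF: "P \<noteq> {}" "F \<noteq> {}" "card F = card P"
    "coeff_of (((-1) ^ (card P * (card P - 1) div 2) * minor A P F) *\<^sub>k
       basis (GX (odd (card P)) F, GX False P)) (p, q) \<noteq> 0"
    by auto
  then have "p = GX (odd (card P)) F" "q = GX False P"
    by (auto simp: scal.rep_eq basis.rep_eq split: if_splits)
  then show thesis using that PF by blast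
qed

lemma R_sign_square:
  assumes "(2 :: 'k::field) \<noteq> 0"
  shows "R_sign * R_sign = (1 :: ('n::{finite,linorder} ebasis \<times> 'n ebasis, 'k) alg)"
proof -
  let ?D = "1 \<otimes>\<^sub>k 1 + 1 \<otimes>\<^sub>k gE + gE \<otimes>\<^sub>k 1 - gE \<otimes>\<^sub>k gE :: ('n ebasis \<times> 'n ebasis, 'k) alg"
  have "?D * ?D = 1 + 1 + 1 + 1"
    by (simp add: algebra_simps tens_mult tens_one)
  then have "R_sign * R_sign = (1 / 4) *\<^sub>k (1 + 1 + 1 + 1 :: ('n ebasis \<times> 'n ebasis, 'k) alg)"
    by (simp add: R_sign_def)
  also have "\<dots> = (1 / 4 + 1 / 4 + 1 / 4 + 1 / 4) *\<^sub>k 1"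
    by (simp only: scal_add_left scal_add_right)
  also have "1 / 4 + 1 / 4 + 1 / 4 + 1 / 4 = (4 :: 'k) / 4" by simp
  also have "(4 :: 'k) = 2 * 2" by simp
  then have "(4 :: 'k) \<noteq> 0" using assms by (simp only: mult_eq_0_iff) simp
  then have "(4 :: 'k) / 4 = 1" by simp
  finally show ?thesis by simp
qed

lemma R_sign_cancel_left:
  assumes "(2 :: 'k::field) \<noteq> 0"
  shows "R_sign * u = R_sign * v \<longleftrightarrow> u = (v :: ('n::{finite,linorder} ebasis \<times> 'n ebasis, 'k) alg)"
proof
  assume "R_sign * u = R_sign * v"
  then have "R_sign * R_sign * u = R_sign * R_sign * v" by (simp add: mult.assoc)
  then show "u = v" by (simp add: R_sign_square[OF assms])
qed simp

text \<open>Both legs of \<open>R_nil\<close> have positive degree, and degrees add up in nonzero products.\<close>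

lemma R_nil_power:
  assumes "coeff_of (R_nil A ^ m) (p, GX b P) \<noteq> 0"
  shows "m \<le> card P"
  using assms
proof (induction m arbitrary: p b P)
  case (Suc m)
  then have nz: "coeff_of (R_nil A * R_nil A ^ m) (p, GX b P) \<noteq> 0" by simp
  obtain x y where xy: "sb_mult x y = (p, GX b P)" "sb_sign x y \<noteq> 0"
      "coeff_of (R_nil A) x \<noteq> 0" "coeff_of (R_nil A ^ m) y \<noteq> 0"
    by (rule coeff_mult_nonzeroE[OF nz])
  obtain p' q' where x: "x = (p', q')" by (cases x)
  obtain P' where P': "P' \<noteq> {}" "q' = GX False P'"
    using xy(3) unfolding x by (rule coeff_of_R_nil_nonzeroE)
  obtain p'' b'' P'' where y: "y = (p'', GX b'' P'')" by (metis ebasis.exhaust prod.exhaust)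
  have "P = P' \<union> P''" "P' \<inter> P'' = {}"
    using xy(1,2) x y P' by (auto simp: sb_mult_prod_def sb_sign_prod_def split: if_splits)
  moreover have "m \<le> card P''" using Suc.IH xy(4) y by blast
  moreover have "1 \<le> card P'" using P'(1) by (simp add: Suc_le_eq card_gt_0_iff)
  ultimately show ?case by (simp add: card_Un_disjoint)
qed simp

lemma R_mat_invertible:
  fixes A :: "'k::field ^ 'n::{finite,linorder} ^ 'n::{finite,linorder}"
  assumes "(2 :: 'k) \<noteq> 0"
  obtains S where "R_mat A * S = 1" "S * R_mat A = 1"
proof -
  \<comment> \<open>The right leg of a nonzero term of the power \<open>m\<close> has degree at
    least \<open>m\<close>, while no monomial has degree above \<open>n\<close>.\<close>
  have "R_nil A ^ Suc (CARD('n)) = 0"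
  proof (rule alg_eqI, clarify)
    fix p q :: "'n ebasis"
    obtain b P where q: "q = GX b P" by (cases q)
    have "\<not> Suc (CARD('n)) \<le> card P" by (simp add: not_less_eq_eq card_mono)
    then show "coeff_of (R_nil A ^ Suc (CARD('n))) (p, q) = coeff_of 0 (p, q)"
      using R_nil_power[of A "Suc (CARD('n))" p b P] by (auto simp: q zero_alg.rep_eq)
  qed
  then obtain Y where Y: "(1 + R_nil A) * Y = 1" "Y * (1 + R_nil A) = 1"
    by (rule one_add_nilpotent_invertible)
  have "R_mat A * (Y * R_sign) = R_sign * ((1 + R_nil A) * Y) * R_sign"
    by (simp only: R_mat_factorization mult.assoc)
  moreover have "Y * R_sign * R_mat A = Y * (R_sign * R_sign) * (1 + R_nil A)"
    by (simp only: R_mat_factorization mult.assoc)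
  ultimately show thesis
    using that[of "Y * R_sign"] Y R_sign_square[OF assms, where 'n='n] by simp
qed

lemma R_sign_commute_even:
  assumes "gE * r = r * (gE :: ('n::{finite,linorder} ebasis, 'k::field) alg)"
  shows "(r \<otimes>\<^sub>k 1) * R_sign = R_sign * (r \<otimes>\<^sub>k 1)" "(1 \<otimes>\<^sub>k r) * R_sign = R_sign * (1 \<otimes>\<^sub>k r)"
  using assms by (simp_all add: R_sign_def algebra_simps tens_mult)

text \<open>An element that anticommutes with \<open>g\<close> interchanges the idempotents
  \<open>(1 + g)/2\<close> and \<open>(1 - g)/2\<close>. This multiplies the other leg by
  \<open>g\<close>.\<close>

lemma R_sign_commute_odd:
  assumes "gE * r = - (r * (gE :: ('n::{finite,linorder} ebasis, 'k::field) alg))"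
  shows "(r \<otimes>\<^sub>k 1) * R_sign = R_sign * (r \<otimes>\<^sub>k gE)" "(1 \<otimes>\<^sub>k r) * R_sign = R_sign * (gE \<otimes>\<^sub>k r)"
  by (simp_all add: R_sign_def distrib_left distrib_right left_diff_distrib right_diff_distrib
      tens_mult assms tens_minus_left tens_minus_right add_diff_eq ac_simps)

lemma gE_swap:
  assumes "\<And>b P. coeff_of u (GX b P) \<noteq> 0 \<Longrightarrow> (-1) ^ card P = c"
  shows "gE * u = c *\<^sub>k (u * (gE :: ('n::{finite,linorder} ebasis, 'k::comm_ring_1) alg))"
proof (rule mult_swap_if_basis_swap)
  fix a b :: "'n ebasis"
  assume "coeff_of (gE :: ('n ebasis, 'k) alg) a \<noteq> 0" and b: "coeff_of u b \<noteq> 0"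
  then have a: "a = GX True {}" by (simp add: gE_def basis.rep_eq split: if_splits)
  obtain d Q where d: "b = GX d Q" by (cases b)
  then show "basis a * basis b = c *\<^sub>k (basis b * basis a :: ('n ebasis, 'k) alg)"
    using assms[of d Q] b ebasis_commute[of True "{}" d Q, where 'k='k]
    by (cases d) (simp_all add: a)
qed

text \<open>\<open>m\<close> stands for the common degree of the legs of a term
  \<open>g^m x_F \<otimes> x_Q\<close> of \<open>R_nil\<close>. The premise makes the total swap
  sign with each such term equal to 1.\<close>

lemma R_nil_commute:
  fixes A :: "'k::field ^ 'n::{finite,linorder} ^ 'n::{finite,linorder}"
  assumes "\<And>a P a' P' m. coeff_of u (GX a P, GX a' P') \<noteq> 0 \<Longrightarrow>
    even ((if odd m then card P else 0) + (if a then m else 0) + card P * m +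
      ((if a' then m else 0) + card P' * m))"
  shows "u * R_nil A = R_nil A * u"
proof -
  have "u * R_nil A = 1 *\<^sub>k (R_nil A * u)"
  proof (rule mult_swap_if_basis_swap)
    fix x y
    assume x: "coeff_of u x \<noteq> 0" and y: "coeff_of (R_nil A) y \<noteq> 0"
    obtain a P a' P' where x': "x = (GX a P, GX a' P')" by (metis ebasis.exhaust prod.exhaust)
    have "coeff_of (R_nil A) (fst y, snd y) \<noteq> 0" using y by simp
    then obtain Q F where QF: "card F = card Q" "y = (GX (odd (card Q)) F, GX False Q)"
      by (rule coeff_of_R_nil_nonzeroE) (metis prod.collapse)
    have "even ((if odd (card Q) then card P else 0) + (if a then card Q else 0) + card P * card Q +
      ((if a' then card Q else 0) + card P' * card Q))"
      by (rule assms) (use x x' in simp)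
    then have "even (((if odd (card Q) then card P else 0) + (if a then card F else 0) + card P * card F) +
      ((if False then card P' else 0) + (if a' then card Q else 0) + card P' * card Q))"
      by (simp only: QF(1) if_False add_0)
    then show "basis x * basis y = (1 :: 'k) *\<^sub>k (basis y * basis x)"
      unfolding x' QF(2) by (subst ebasis_tens_commute) (simp only: neg_one_even_power)
  qed
  then show ?thesis by simp
qed

text \<open>Multiplication never lowers degrees, so a factor \<open>R_nil\<close> keeps both legs of
  the product in positive degree. Hence it is invisible in coordinates with a leg of degree
  0.\<close>

lemma coeff_of_mult_R_nil_degree_zero:
  assumes "u = R_nil A \<or> v = R_nil A"
  shows "coeff_of (u * v) (GX a {}, q) = 0" "coeff_of (u * v) (p, GX b {}) = 0"
proof -
  have *: "P \<noteq> {} \<and> Q \<noteq> {}" if nz: "coeff_of (u * v) (GX a P, GX b Q) \<noteq> 0" for a b P Q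
  proof -
    obtain x y where xy: "sb_mult x y = (GX a P, GX b Q)" "coeff_of u x \<noteq> 0" "coeff_of v y \<noteq> 0"
      using nz by (rule coeff_mult_nonzeroE)
    obtain P' Q' a' b' where x: "x = (GX a' P', GX b' Q')" by (metis ebasis.exhaust prod.exhaust)
    obtain P'' Q'' a'' b'' where y: "y = (GX a'' P'', GX b'' Q'')"
      by (metis ebasis.exhaust prod.exhaust)
    have "P' \<noteq> {} \<and> Q' \<noteq> {} \<or> P'' \<noteq> {} \<and> Q'' \<noteq> {}"
      using assms xy(2,3) unfolding x y by (auto elim!: coeff_of_R_nil_nonzeroE)
    then show ?thesis using xy(1) by (auto simp: x y sb_mult_prod_def)
  qed
  show "coeff_of (u * v) (GX a {}, q) = 0" using * by (cases q) blast
  show "coeff_of (u * v) (p, GX b {}) = 0" using * by (cases p) blast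
qed

lemmas coeff_of_R_nil_mult = coeff_of_mult_R_nil_degree_zero[OF disjI1[OF refl]]
lemmas coeff_of_mult_R_nil = coeff_of_mult_R_nil_degree_zero[OF disjI2[OF refl]]

section \<open>Conjugates of elements living on one leg\<close>

context
  fixes A :: "'k::field ^ 'n::{finite,linorder} ^ 'n::{finite,linorder}"
    and S :: "('n ebasis \<times> 'n ebasis, 'k) alg"
  assumes two: "(2 :: 'k) \<noteq> 0"
    and RS: "R_mat A * S = 1" and SR: "S * R_mat A = 1"
begin

text \<open>The outer \<open>R_sign\<close> factors cancel, leaving conjugation by the unipotent
  part alone, written without its inverse.\<close>

lemma one_add_R_nil_conj:
  assumes "u * R_sign = R_sign * u"
  shows "(1 + R_nil A) * (S * u * R_mat A) = u * (1 + R_nil A)"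
proof -
  have "R_sign * ((1 + R_nil A) * (S * u * R_mat A)) = (R_mat A * S) * u * R_mat A"
    by (simp only: R_mat_factorization[of A] mult.assoc)
  also have "\<dots> = u * R_sign * (1 + R_nil A)"
    by (simp only: RS mult_1_left) (simp only: R_mat_factorization mult.assoc)
  also have "\<dots> = R_sign * (u * (1 + R_nil A))"
    by (simp only: assms mult.assoc)
  finally show ?thesis by (simp only: R_sign_cancel_left[OF two])
qed

lemma coeff_of_conj_left_leg:
  assumes "gE * r = r * gE"
  shows "coeff_of (S * (r \<otimes>\<^sub>k 1) * R_mat A) (p, GX False {}) = coeff_of r p"
proof -
  let ?U = "S * (r \<otimes>\<^sub>k 1) * R_mat A"
  have "(1 + R_nil A) * ?U = (r \<otimes>\<^sub>k 1) * (1 + R_nil A)"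
    by (rule one_add_R_nil_conj) (rule R_sign_commute_even[OF assms])
  \<comment> \<open>With 1 in the second leg, every term containing \<open>R_nil\<close> drops
    out.\<close>
  then have "coeff_of (?U + R_nil A * ?U) (p, GX False {}) =
      coeff_of (r \<otimes>\<^sub>k 1 + (r \<otimes>\<^sub>k 1) * R_nil A) (p, GX False {})"
    by (simp only: distrib_left distrib_right mult_1_left mult_1_right)
  then show ?thesis
    by (simp add: plus_alg.rep_eq coeff_of_R_nil_mult coeff_of_mult_R_nil tens.rep_eq one_alg.rep_eq
        sb_one_ebasis_def)
qed

lemma coeff_of_conj_right_leg:
  assumes "gE * r = r * gE"
  shows "coeff_of (S * (1 \<otimes>\<^sub>k r) * R_mat A) (GX False {}, q) = coeff_of r q"
proof -
  let ?U = "S * (1 \<otimes>\<^sub>k r) * R_mat A"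
  have "(1 + R_nil A) * ?U = (1 \<otimes>\<^sub>k r) * (1 + R_nil A)"
    by (rule one_add_R_nil_conj) (rule R_sign_commute_even[OF assms])
  then have "coeff_of (?U + R_nil A * ?U) (GX False {}, q) =
      coeff_of (1 \<otimes>\<^sub>k r + (1 \<otimes>\<^sub>k r) * R_nil A) (GX False {}, q)"
    by (simp only: distrib_left distrib_right mult_1_left mult_1_right)
  then show ?thesis
    by (simp add: plus_alg.rep_eq coeff_of_R_nil_mult coeff_of_mult_R_nil tens.rep_eq one_alg.rep_eq
        sb_one_ebasis_def)
qed

lemma conj_eqI:
  assumes "u * R_sign = R_sign * v" "v * R_nil A = R_nil A * v"
  shows "S * u * R_mat A = v"
proof -
  have "u * R_mat A = R_sign * (v * (1 + R_nil A))"
    by (simp only: R_mat_factorization assms(1) flip: mult.assoc)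
  also have "\<dots> = R_mat A * v"
    by (simp only: R_mat_factorization mult.assoc distrib_left distrib_right assms(2)
        mult_1_left mult_1_right)
  finally have "S * u * R_mat A = (S * R_mat A) * v" by (simp only: mult.assoc)
  then show ?thesis by (simp only: SR mult_1_left)
qed

text \<open>Crossing \<open>R_sign\<close> leaves a \<open>g\<close> in the other leg. The resulting
  \<open>r \<otimes> g\<close> commutes with \<open>R_nil\<close>: for odd \<open>m\<close> the swap
  exponent has four odd summands, for even \<open>m\<close> all summands are even.\<close>

lemma conj_left_leg_odd:
  assumes "\<And>b P. coeff_of r (GX b P) \<noteq> 0 \<Longrightarrow> b \<and> odd (card P)"
  shows "S * (r \<otimes>\<^sub>k 1) * R_mat A = r \<otimes>\<^sub>k gE"
proof (rule conj_eqI)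
  have "gE * r = (- 1) *\<^sub>k (r * gE)"
    by (rule gE_swap) (use assms in auto)
  then show "(r \<otimes>\<^sub>k 1) * R_sign = R_sign * (r \<otimes>\<^sub>k gE)" by (intro R_sign_commute_odd) simp
  show "(r \<otimes>\<^sub>k gE) * R_nil A = R_nil A * (r \<otimes>\<^sub>k gE)"
  proof (rule R_nil_commute)
    fix a a' :: bool and P P' :: "'n set" and m :: nat
    assume "coeff_of (r \<otimes>\<^sub>k gE) (GX a P, GX a' P') \<noteq> 0"
    then have "coeff_of r (GX a P) \<noteq> 0" "a'" "P' = {}"
      by (auto simp: tens.rep_eq gE_def basis.rep_eq split: if_splits)
    then show "even ((if odd m then card P else 0) + (if a then m else 0) + card P * m +
      ((if a' then m else 0) + card P' * m))"
      using assms[of a P] by auto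
  qed
qed

lemma conj_right_leg_odd:
  assumes "\<And>b P. coeff_of r (GX b P) \<noteq> 0 \<Longrightarrow> \<not> b \<and> odd (card P)"
  shows "S * (1 \<otimes>\<^sub>k r) * R_mat A = gE \<otimes>\<^sub>k r"
proof (rule conj_eqI)
  have "gE * r = (- 1) *\<^sub>k (r * gE)"
    by (rule gE_swap) (use assms in auto)
  then show "(1 \<otimes>\<^sub>k r) * R_sign = R_sign * (gE \<otimes>\<^sub>k r)" by (intro R_sign_commute_odd) simp
  show "(gE \<otimes>\<^sub>k r) * R_nil A = R_nil A * (gE \<otimes>\<^sub>k r)"
  proof (rule R_nil_commute)
    fix a a' :: bool and P P' :: "'n set" and m :: nat
    assume "coeff_of (gE \<otimes>\<^sub>k r) (GX a P, GX a' P') \<noteq> 0"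
    then have "coeff_of r (GX a' P') \<noteq> 0" "a" "P = {}"
      by (auto simp: tens.rep_eq gE_def basis.rep_eq split: if_splits)
    then show "even ((if odd m then card P else 0) + (if a then m else 0) + card P * m +
      ((if a' then m else 0) + card P' * m))"
      using assms[of a' P'] by auto
  qed
qed

end

section \<open>Infinitesimal R-matrices on E(n)\<close>

text \<open>The commutation axiom at \<open>h = g\<close> says that \<chi> commutes with
  \<open>g \<otimes> g\<close>. Terms of odd total degree equal their own negatives, hence vanish in
  characteristic other than 2.\<close>

lemma infinitesimal_parity:
  fixes A :: "'k::field ^ 'n::{finite,linorder} ^ 'n::{finite,linorder}"
  assumes two: "(2 :: 'k) \<noteq> 0"
    and inf: "infinitesimal_R_matrix E_comult (R_mat A) \<chi>"
    and nz: "coeff_of \<chi> (GX a P, GX b Q) \<noteq> 0"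
  shows "even (card P + card Q)"
proof -
  let ?g = "(GX True {}, GX True {}) :: 'n ebasis \<times> 'n ebasis"
  have g: "E_comult gE = (basis ?g :: (_, 'k) alg)"
    by (simp only: E_comult_hom) (simp only: gE_def tens_basis)
  have comm: "basis ?g * \<chi> = \<chi> * basis ?g"
    using inf unfolding infinitesimal_R_matrix_def by (metis g)
  have "coeff_of \<chi> (GX a P, GX b Q) =
      (case (GX a P, GX b Q) of (GX _ P, GX _ Q) \<Rightarrow> (-1) ^ (card P + card Q)) *
      coeff_of \<chi> (GX a P, GX b Q)"
  proof (rule coeff_of_commute_basis[OF comm])
    show "basis ?g * basis ?g = (1 :: (_, 'k) alg)"
      by (simp add: tens_mult tens_one flip: tens_basis gE_def)
    fix x :: "'n ebasis \<times> 'n ebasis"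
    obtain a P b Q where x: "x = (GX a P, GX b Q)" by (metis ebasis.exhaust prod.exhaust)
    show "basis ?g * basis x =
      (case x of (GX _ P, GX _ Q) \<Rightarrow> (-1) ^ (card P + card Q)) *\<^sub>k (basis x * basis ?g :: (_, 'k) alg)"
      unfolding x by (subst ebasis_tens_commute) simp
  qed
  then have eq: "coeff_of \<chi> (GX a P, GX b Q) = (-1) ^ (card P + card Q) * coeff_of \<chi> (GX a P, GX b Q)"
    by simp
  show ?thesis
  proof (rule ccontr)
    assume "odd (card P + card Q)"
    then have "(-1) ^ (card P + card Q) = (-1 :: 'k)" by simp
    with eq have "coeff_of \<chi> (GX a P, GX b Q) = - coeff_of \<chi> (GX a P, GX b Q)"
      by (simp only: mult_minus1)
    then have "2 * coeff_of \<chi> (GX a P, GX b Q) = 0" by (simp only: mult_2 eq_neg_iff_add_eq_0)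
    then show False using two nz by simp
  qed
qed

lemma infinitesimal_support:
  fixes A :: "'k::field ^ 'n::{finite,linorder} ^ 'n::{finite,linorder}"
  assumes two: "(2 :: 'k) \<noteq> 0"
    and inf: "infinitesimal_R_matrix E_comult (R_mat A) \<chi>"
    and nz: "coeff_of \<chi> (p, q) \<noteq> 0"
  shows "\<exists>i j. p = GX True {i} \<and> q = GX False {j}"
proof -
  obtain S where RS: "R_mat A * S = 1" "S * R_mat A = 1"
    using R_mat_invertible[OF two] .
  note parity = infinitesimal_parity[OF two inf]
  note eqs = infinitesimal_R_matrix_coeffs[OF inf RS E_comult_expansion]
  note conj = coeff_of_conj_left_leg[OF two RS] coeff_of_conj_right_leg[OF two RS]
  have even_slices: "gE * right_slice (GX b {}) \<chi> = right_slice (GX b {}) \<chi> * gE"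
    "gE * left_slice (GX b {}) \<chi> = left_slice (GX b {}) \<chi> * gE" for b
  proof -
    have "gE * right_slice (GX b {}) \<chi> = 1 *\<^sub>k (right_slice (GX b {}) \<chi> * gE)"
      by (rule gE_swap) (use parity in \<open>force simp: right_slice.rep_eq\<close>)
    then show "gE * right_slice (GX b {}) \<chi> = right_slice (GX b {}) \<chi> * gE" by simp
    have "gE * left_slice (GX b {}) \<chi> = 1 *\<^sub>k (left_slice (GX b {}) \<chi> * gE)"
      by (rule gE_swap) (use parity in \<open>force simp: left_slice.rep_eq\<close>)
    then show "gE * left_slice (GX b {}) \<chi> = left_slice (GX b {}) \<chi> * gE" by simp
  qed
  \<comment> \<open>\<open>1 \<otimes> g\<close> occurs in no coproduct, so at
    \<open>(a, 1, g)\<close> only the coefficient of \<chi> at \<open>a \<otimes> g\<close>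
    survives.\<close>
  have right_g: "right_slice (GX True {}) \<chi> = 0"
    by (rule alg_eqI)
      (use eqs(1)[of _ "GX False {}" "GX True {}"] in
        \<open>simp add: coeff_of_E_comult conj even_slices sb_one_ebasis_def zero_alg.rep_eq\<close>)
  \<comment> \<open>At \<open>(a, g x_Q, g)\<close> the right-hand side is 0 by the previous step,
    so no \<open>g\<close> occurs in the second leg.\<close>
  have no_g: "coeff_of \<chi> (a, GX True Q) = 0" for a Q
    using eqs(1)[of a "GX True Q" "GX True {}"]
    by (simp add: coeff_of_E_comult right_g zero_alg.rep_eq sb_one_ebasis_def left_slice.rep_eq)
  \<comment> \<open>At \<open>(a, 1, 1)\<close> the axiom reads \<open>x = x + x\<close> for the
    coefficient \<open>x\<close> at \<open>a \<otimes> 1\<close>.\<close>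
  have "(2 :: 'k) \<noteq> 1" by (metis add_cancel_left_right one_add_one zero_neq_one)
  then have no_1: "coeff_of \<chi> (a, GX False {}) = 0" for a
    using eqs(1)[of a "GX False {}" "GX False {}"]
    by (simp add: coeff_of_E_comult conj even_slices sb_one_ebasis_def left_slice.rep_eq
        right_slice.rep_eq)
  have left_g: "left_slice (GX True {}) \<chi> = 0"
    by (rule alg_eqI)
      (use eqs(2)[of _ "GX True {}" "GX False {}"] in
        \<open>simp add: coeff_of_E_comult conj even_slices sb_one_ebasis_def zero_alg.rep_eq\<close>)
  \<comment> \<open>At \<open>(g, b, c)\<close> with this \<open>b\<close>, the coproduct gives
    exactly the coefficient of \<chi> at \<open>b \<otimes> c\<close>. So \<open>g\<close>
    accompanies \<open>x_P\<close> in the first leg precisely for odd degree.\<close>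
  have left_type: "coeff_of \<chi> (GX (even (card P)) P, c) = 0" for P c
    using eqs(2)[of c "GX True {}" "GX (even (card P)) P"]
    by (simp add: coeff_of_E_comult left_g zero_alg.rep_eq sb_one_ebasis_def right_slice.rep_eq)
  have left_odd: "b \<and> odd (card P)" if "coeff_of \<chi> (GX b P, GX False {i}) \<noteq> 0" for b P i
  proof -
    have "odd (card P)" using parity[OF that] by simp
    moreover from this have "b" using that left_type[of P] by (cases b) auto
    ultimately show ?thesis by blast
  qed
  have right_singleton: "\<exists>j. q = GX False {j}" if q: "coeff_of \<chi> (a, q) \<noteq> 0" for a q
  proof -
    obtain b Q where "q = GX b Q" by (cases q)
    then have Q: "q = GX False Q" "Q \<noteq> {}" using q no_g[of a Q] no_1[of a] by (cases b; auto)+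
    then obtain i where i: "i \<in> Q" by blast
    let ?Q = "Q - {i}"
    \<comment> \<open>The conjugated slice has only \<open>g\<close> in its second leg, whereas the
      coproduct at \<open>(a, g x_{Q-i}, x_i)\<close> sees the coefficient at \<open>x_Q\<close>.
      Hence nothing but \<open>i\<close> can lie in \<open>Q\<close>.\<close>
    have "S * (right_slice (GX False {i}) \<chi> \<otimes>\<^sub>k 1) * R_mat A = right_slice (GX False {i}) \<chi> \<otimes>\<^sub>k gE"
      by (rule conj_left_leg_odd[OF two RS]) (rule left_odd, simp add: right_slice.rep_eq)
    then have "(-1) ^ inversions {i} ?Q * coeff_of \<chi> (a, GX False Q) =
        coeff_of (right_slice (GX False {i}) \<chi>) a * coeff_of gE (GX True ?Q)"
      using eqs(1)[of a "GX True ?Q" "GX False {i}"] i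
      by (simp add: coeff_of_E_comult sb_one_ebasis_def left_slice.rep_eq tens.rep_eq insert_absorb)
    moreover have "coeff_of \<chi> (a, GX False Q) \<noteq> 0" using q Q by simp
    ultimately have "?Q = {}" by (auto simp: gE_def basis.rep_eq split: if_splits)
    with i have "Q = {i}" by auto
    then show ?thesis using Q by simp
  qed
  obtain j where j: "q = GX False {j}" using right_singleton[OF nz] by blast
  obtain b P where "p = GX b P" by (cases p)
  then have P: "p = GX True P" "odd (card P)" using nz left_odd[of b P j] j by auto
  then obtain i where i: "i \<in> P" by fastforce
  let ?P = "P - {i}"
  \<comment> \<open>The mirror argument at \<open>(g x_i, g x_{P-i}, q)\<close>; the middle entry
    carries a \<open>g\<close> because \<open>P - {i}\<close> has even size.\<close>
  have "S * (1 \<otimes>\<^sub>k left_slice (GX True {i}) \<chi>) * R_mat A = gE \<otimes>\<^sub>k left_slice (GX True {i}) \<chi>"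
  proof (rule conj_right_leg_odd[OF two RS])
    fix b P
    assume "coeff_of (left_slice (GX True {i}) \<chi>) (GX b P) \<noteq> 0"
    then obtain k where "GX b P = GX False {k}"
      using right_singleton[of "GX True {i}" "GX b P"] by (auto simp: left_slice.rep_eq)
    then show "\<not> b \<and> odd (card P)" by simp
  qed
  then have "(-1) ^ inversions ?P {i} * coeff_of \<chi> (GX True P, q) =
      coeff_of gE (GX True ?P) * coeff_of (left_slice (GX True {i}) \<chi>) q"
    using eqs(2)[of q "GX True {i}" "GX True ?P"] i P
    by (simp add: coeff_of_E_comult sb_one_ebasis_def right_slice.rep_eq tens.rep_eq insert_absorb)
  then have "?P = {}" using nz P(1) by (auto simp: gE_def basis.rep_eq split: if_splits)
  with i have "P = {i}" by auto
  then show ?thesis using P(1) j by blast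
qed

lemma infinitesimal_expansion:
  fixes \<chi> :: "('n::{finite,linorder} ebasis \<times> 'n ebasis, 'k::comm_ring_1) alg"
  assumes "\<And>p q. coeff_of \<chi> (p, q) \<noteq> 0 \<Longrightarrow> \<exists>i j. p = GX True {i} \<and> q = GX False {j}"
  shows "\<chi> = (\<Sum>i\<in>UNIV. \<Sum>j\<in>UNIV.
    coeff_of \<chi> (GX True {i}, GX False {j}) *\<^sub>k basis (GX True {i}, GX False {j}))"
proof -
  let ?b = "\<lambda>(i, j). (GX True {i}, GX False {j}) :: 'n ebasis \<times> 'n ebasis"
  have "\<chi> = (\<Sum>x\<in>UNIV. coeff_of \<chi> x *\<^sub>k basis x)" by (rule basis_expansion)
  also have "\<dots> = (\<Sum>x\<in>range ?b. coeff_of \<chi> x *\<^sub>k basis x)"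
  proof (rule sum.mono_neutral_right)
    show "\<forall>x\<in>UNIV - range ?b. coeff_of \<chi> x *\<^sub>k basis x = 0"
    proof
      fix x assume "x \<in> UNIV - range ?b"
      then have "coeff_of \<chi> (fst x, snd x) = 0"
        using assms[of "fst x" "snd x"] by (auto simp: image_iff prod_eq_iff)
      then show "coeff_of \<chi> x *\<^sub>k basis x = 0" by simp
    qed
  qed auto
  also have "\<dots> = (\<Sum>z\<in>UNIV. coeff_of \<chi> (?b z) *\<^sub>k basis (?b z))"
    by (subst sum.reindex) (auto simp: inj_on_def)
  finally show ?thesis by (simp add: sum_UNIV_prod)
qed

section \<open>The Cartier condition as skew-symmetry\<close>

lemma flip_legs_scal_basis: "flip_legs (c *\<^sub>k basis (p, q)) = c *\<^sub>k basis (q, p)"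
  by (rule alg_eqI) (auto simp: flip_legs.rep_eq scal.rep_eq basis.rep_eq split: if_splits)

lemma flip_legs_sum: "flip_legs (sum f I) = (\<Sum>i\<in>I. flip_legs (f i))"
  for f :: "'s \<Rightarrow> ('a::signed_basis \<times> 'b::signed_basis, 'k::comm_ring_1) alg"
  by (rule alg_eqI) (auto simp: flip_legs.rep_eq coeff_of_sum)

text \<open>Both legs are odd, so each sends a \<open>g\<close> to the other: one cancels the
  \<open>g\<close> of \<open>g x_i\<close>, the other turns \<open>x_j\<close> into
  \<open>x_j g = - g x_j\<close>. This sign is the source of skew-symmetry.\<close>

lemma basis_flip_R_sign:
  "basis (GX False {j}, GX True {i}) * R_sign =
    - (R_sign * basis (GX True {j}, GX False {i}) :: ('n::{finite,linorder} ebasis \<times> 'n ebasis, 'k::field) alg)"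
proof -
  have odd: "gE * basis (GX b {k}) = - (basis (GX b {k}) * gE :: ('n ebasis, 'k) alg)" for b k
    by (simp add: gE_def basis_mult)
  let ?x = "basis (GX False {j}) :: ('n ebasis, 'k) alg"
  let ?y = "basis (GX True {i}) :: ('n ebasis, 'k) alg"
  have "basis (GX False {j}, GX True {i}) * R_sign = (?x \<otimes>\<^sub>k 1) * ((1 \<otimes>\<^sub>k ?y) * R_sign)"
    by (simp add: tens_mult flip: tens_basis mult.assoc)
  also have "\<dots> = (?x \<otimes>\<^sub>k 1) * R_sign * (gE \<otimes>\<^sub>k ?y)"
    by (simp only: R_sign_commute_odd(2)[OF odd] mult.assoc)
  also have "\<dots> = R_sign * (?x \<otimes>\<^sub>k gE) * (gE \<otimes>\<^sub>k ?y)"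
    by (simp only: R_sign_commute_odd(1)[OF odd])
  also have "\<dots> = R_sign * ((?x * gE) \<otimes>\<^sub>k (gE * ?y))"
    by (simp only: mult.assoc tens_mult)
  also have "?x * gE = - basis (GX True {j})" by (simp add: gE_def basis_mult)
  also have "gE * ?y = basis (GX False {i})" by (simp add: gE_def basis_mult)
  finally show ?thesis by (simp add: tens_minus_left tens_basis)
qed

lemma cartier_iff_skew:
  fixes A :: "'k::field ^ 'n::{finite,linorder} ^ 'n::{finite,linorder}"
  assumes two: "(2 :: 'k) \<noteq> 0"
    and inf: "infinitesimal_R_matrix E_comult (R_mat A) \<chi>"
  shows "cartier E_comult (R_mat A) \<chi> \<longleftrightarrow>
    (\<forall>i j. coeff_of \<chi> (GX True {i}, GX False {j}) = - coeff_of \<chi> (GX True {j}, GX False {i}))"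
proof -
  note supp = infinitesimal_support[OF two inf]
  let ?c = "\<lambda>i j. coeff_of \<chi> (GX True {i}, GX False {j})"
  let ?Y = "\<lambda>i j. basis (GX True {i}, GX False {j}) :: ('n ebasis \<times> 'n ebasis, 'k) alg"
  \<comment> \<open>\<chi>' carries the transposed coefficient matrix; up to sign it is what the
    flip of \<chi> becomes after crossing \<open>R_sign\<close>.\<close>
  define \<chi>' where "\<chi>' = (\<Sum>i\<in>UNIV. \<Sum>j\<in>UNIV. ?c i j *\<^sub>k ?Y j i)"
  have supp_commute: "u * R_nil A = R_nil A * u"
    if supp_u: "\<And>p q. coeff_of u (p, q) \<noteq> 0 \<Longrightarrow> \<exists>i j. p = GX True {i} \<and> q = GX False {j}" for u
  proof (rule R_nil_commute)
    fix a a' :: bool and P P' :: "'n set" and m :: nat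
    assume "coeff_of u (GX a P, GX a' P') \<noteq> 0"
    then obtain i j where "GX a P = GX True {i}" "GX a' P' = GX False {j}" using supp_u by blast
    then show "even ((if odd m then card P else 0) + (if a then m else 0) + card P * m +
      ((if a' then m else 0) + card P' * m))"
      by simp
  qed
  have c': "coeff_of \<chi>' (p, q) = (\<Sum>i\<in>UNIV. \<Sum>j\<in>UNIV.
      if p = GX True {j} \<and> q = GX False {i} then ?c i j else 0)" for p q
    unfolding \<chi>'_def coeff_of_sum by (intro sum.cong refl) (auto simp: scal.rep_eq basis.rep_eq)
  have c'_ij: "coeff_of \<chi>' (GX True {i}, GX False {j}) = ?c j i" for i j
  proof -
    have "coeff_of \<chi>' (GX True {i}, GX False {j}) =
        (\<Sum>a\<in>UNIV. if j = a then \<Sum>b\<in>UNIV. if i = b then ?c a b else 0 else 0)"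
      unfolding c' by (intro sum.cong refl) auto
    then show ?thesis by simp
  qed
  have supp': "\<exists>i j. p = GX True {i} \<and> q = GX False {j}" if nz: "coeff_of \<chi>' (p, q) \<noteq> 0" for p q
  proof -
    obtain i where "(\<Sum>j\<in>UNIV. if p = GX True {j} \<and> q = GX False {i} then ?c i j else 0) \<noteq> 0"
      using nz unfolding c' by (rule sum.not_neutral_contains_not_neutral)
    then obtain j where "(if p = GX True {j} \<and> q = GX False {i} then ?c i j else 0) \<noteq> 0"
      by (rule sum.not_neutral_contains_not_neutral)
    then show ?thesis by (auto split: if_splits)
  qed
  have comm: "\<chi> * R_nil A = R_nil A * \<chi>"
    by (rule supp_commute) (rule supp)
  have "flip_legs \<chi> * R_sign = - (R_sign * \<chi>')"
    by (subst infinitesimal_expansion[OF supp])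
      (simp_all add: flip_legs_sum flip_legs_scal_basis \<chi>'_def sum_distrib_right sum_distrib_left
        basis_flip_R_sign sum_negf)
  then have "flip_legs \<chi> * R_mat A = R_sign * (- \<chi>' * (1 + R_nil A))"
    by (simp only: R_mat_factorization mult_minus_left mult_minus_right mult.assoc flip: mult.assoc)
  moreover have "R_mat A * \<chi> = R_sign * (\<chi> * (1 + R_nil A))"
    by (simp only: R_mat_factorization mult.assoc distrib_left distrib_right
        comm mult_1_left mult_1_right)
  ultimately have "cartier E_comult (R_mat A) \<chi> \<longleftrightarrow> \<chi> * (1 + R_nil A) = - \<chi>' * (1 + R_nil A)"
    by (simp only: cartier_def inf simp_thms R_sign_cancel_left[OF two])
  also have "\<dots> \<longleftrightarrow> \<chi> = - \<chi>'"
  proof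
    assume eq: "\<chi> * (1 + R_nil A) = - \<chi>' * (1 + R_nil A)"
    obtain S where S: "R_mat A * S = 1" by (rule R_mat_invertible[OF two])
    \<comment> \<open>Since \<open>R_sign\<close> is an involution, \<open>1 + R_nil A\<close>
      equals \<open>R_sign * R_mat A\<close> and inherits a right inverse.\<close>
    have "(1 + R_nil A) * S * R_sign = R_sign * (R_mat A * S) * R_sign"
      by (simp only: R_mat_factorization R_sign_square[OF two] mult_1_left flip: mult.assoc)
    then have inv: "(1 + R_nil A) * (S * R_sign) = 1"
      by (simp add: S R_sign_square[OF two] mult.assoc)
    have "\<chi> * (1 + R_nil A) * (S * R_sign) = - \<chi>' * (1 + R_nil A) * (S * R_sign)"
      by (simp only: eq)
    then show "\<chi> = - \<chi>'" by (simp only: mult.assoc inv mult_1_right)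
  qed simp
  also have "\<dots> \<longleftrightarrow> (\<forall>i j. ?c i j = - ?c j i)"
  proof
    assume eq: "\<chi> = - \<chi>'"
    show "\<forall>i j. ?c i j = - ?c j i"
      by (subst (1) eq) (simp add: uminus_alg.rep_eq c'_ij)
  next
    assume skew: "\<forall>i j. ?c i j = - ?c j i"
    show "\<chi> = - \<chi>'"
    proof (rule alg_eqI, clarify)
      fix p q
      show "coeff_of \<chi> (p, q) = coeff_of (- \<chi>') (p, q)"
      proof (cases "\<exists>i j. p = GX True {i} \<and> q = GX False {j}")
        case True
        then obtain i j where "p = GX True {i}" "q = GX False {j}" by blast
        then show ?thesis using skew[rule_format, of i j] by (simp add: c'_ij uminus_alg.rep_eq)
      next
        case False
        then have "coeff_of \<chi> (p, q) = 0" "coeff_of \<chi>' (p, q) = 0" using supp supp' by blast+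
        then show ?thesis by (simp add: uminus_alg.rep_eq)
      qed
    qed
  qed
  finally show ?thesis .
qed

section \<open>Coboundaries and skew-symmetry\<close>

lemma two_coboundary_skew:
  fixes \<chi> :: "('n::{finite,linorder} ebasis \<times> 'n ebasis, 'b::comm_ring_1) alg"
  assumes "two_coboundary E_comult \<chi>"
  shows "coeff_of \<chi> (GX True {i}, GX False {j}) = - coeff_of \<chi> (GX True {j}, GX False {i})"
proof -
  obtain \<alpha> where \<alpha>: "\<chi> = 1 \<otimes>\<^sub>k \<alpha> - E_comult \<alpha> + \<alpha> \<otimes>\<^sub>k 1"
    using assms unfolding two_coboundary_def by blast
  \<comment> \<open>Only the coproduct of \<alpha> contributes here, through the coefficient at
    \<open>{i, j}\<close>; exchanging \<open>i\<close> and \<open>j\<close> affects nothing but the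
    inversion sign.\<close>
  have *: "coeff_of \<chi> (GX True {i}, GX False {j}) =
      (if i = j then 0 else - ((-1) ^ inversions {j} {i} * coeff_of \<alpha> (GX False {i, j})))" for i j
    by (simp add: \<alpha> plus_alg.rep_eq minus_alg.rep_eq tens.rep_eq one_alg.rep_eq sb_one_ebasis_def
        coeff_of_E_comult insert_commute)
  have "inversions {j} {i} = 1 \<and> inversions {i} {j} = 0 \<or> inversions {j} {i} = 0 \<and> inversions {i} {j} = 1"
    if "i \<noteq> j"
    using inversions_add_swap[of "{i}" "{j}"] that by auto
  then have sign: "(-1) ^ inversions {i} {j} = - ((-1) ^ inversions {j} {i}) * (1 :: 'b)" if "i \<noteq> j"
    using that by auto
  have sym: "coeff_of \<alpha> (GX False {j, i}) = coeff_of \<alpha> (GX False {i, j})"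
    by (rule arg_cong[where f = "\<lambda>P. coeff_of \<alpha> (GX False P)"]) auto
  show ?thesis
  proof (cases "i = j")
    case True
    then show ?thesis using *[of i j] by simp
  next
    case False
    have 1: "coeff_of \<chi> (GX True {i}, GX False {j}) =
        - ((-1) ^ inversions {j} {i} * coeff_of \<alpha> (GX False {i, j}))"
      using *[of i j] False by (simp only: if_False)
    have "coeff_of \<chi> (GX True {j}, GX False {i}) =
        - ((-1) ^ inversions {i} {j} * coeff_of \<alpha> (GX False {j, i}))"
      using *[of j i] not_sym[OF False] by (simp only: if_False)
    then show ?thesis unfolding 1 sym sign[OF False] by simp
  qed
qed

lemma two_coboundary_if_skew:
  fixes \<chi> :: "('n::{finite,linorder} ebasis \<times> 'n ebasis, 'k::field) alg"
  assumes two: "(2 :: 'k) \<noteq> 0"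
    and supp: "\<And>p q. coeff_of \<chi> (p, q) \<noteq> 0 \<Longrightarrow> \<exists>i j. p = GX True {i} \<and> q = GX False {j}"
    and skew: "\<And>i j. coeff_of \<chi> (GX True {i}, GX False {j}) = - coeff_of \<chi> (GX True {j}, GX False {i})"
  shows "two_coboundary E_comult \<chi>"
proof -
  let ?c = "\<lambda>i j. coeff_of \<chi> (GX True {i}, GX False {j})"
  let ?Y = "\<lambda>i j. basis (GX True {i}, GX False {j}) :: ('n ebasis \<times> 'n ebasis, 'k) alg"
  let ?D = "\<lambda>u :: ('n ebasis, 'k) alg. 1 \<otimes>\<^sub>k u - E_comult u + u \<otimes>\<^sub>k 1"
  have D_sum: "?D (sum f I) = (\<Sum>i\<in>I. ?D (f i))" for I :: "'n set" and f
  proof (induction I rule: infinite_finite_induct)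
    case (insert x F)
    then show ?case by (simp add: E_comult_def E_lift_add tens_add_left tens_add_right)
  \<comment> \<open>Sums over empty or infinite sets are 0, so these cases need that the coproduct
    of 0 is 0, obtained from the empty sum.\<close>
  qed (simp_all add: E_comult_def E_lift_sum[of _ _ "\<lambda>_. 0" "{}", simplified])
  have tens_scal': "(c *\<^sub>k u) \<otimes>\<^sub>k 1 = c *\<^sub>k (u \<otimes>\<^sub>k 1)" "1 \<otimes>\<^sub>k (c *\<^sub>k u) = c *\<^sub>k (1 \<otimes>\<^sub>k u)"
    for c and u :: "('n ebasis, 'k) alg"
    using tens_scal[of c u 1 1] tens_scal[of 1 1 c u] by simp_all
  have D_scal: "?D (c *\<^sub>k u) = c *\<^sub>k ?D u" for c u
    by (rule alg_eqI)
      (simp add: E_comult_def E_lift_scal tens_scal' scal.rep_eq plus_alg.rep_eq minus_alg.rep_eq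
        algebra_simps)
  have D_xx: "?D (xE i * xE j) = ?Y i j - ?Y j i" for i j
  proof -
    have gx: "xE i * gE = (- basis (GX True {i}) :: ('n ebasis, 'k) alg)"
      "gE * xE i = (basis (GX True {i}) :: ('n ebasis, 'k) alg)" for i
      by (simp_all add: gE_def xE_def basis_mult)
    have Y: "?Y i j = basis (GX True {i}) \<otimes>\<^sub>k xE j" for i j
      by (simp add: xE_def tens_basis)
    show ?thesis
      by (simp only: Y E_comult_hom distrib_left distrib_right tens_mult mult_1_left mult_1_right gx
          gE_gE)
        (simp add: tens_minus_left)
  qed
  \<comment> \<open>By \<open>D_xx\<close>, the coboundary of this element has coefficients
    \<open>(c_ij - c_ji)/2\<close>; the half compensates for skew-symmetry doubling them.\<close>
  let ?\<alpha> = "\<Sum>i\<in>UNIV. \<Sum>j\<in>UNIV. (?c i j / 2) *\<^sub>k (xE i * xE j :: ('n ebasis, 'k) alg)"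
  have "?D ?\<alpha> = (\<Sum>i\<in>UNIV. \<Sum>j\<in>UNIV. (?c i j / 2) *\<^sub>k (?Y i j - ?Y j i))"
    by (simp only: D_sum D_scal D_xx)
  also have "\<dots> = (\<Sum>i\<in>UNIV. \<Sum>j\<in>UNIV. (?c i j / 2) *\<^sub>k ?Y i j) -
      (\<Sum>i\<in>UNIV. \<Sum>j\<in>UNIV. (?c i j / 2) *\<^sub>k ?Y j i)"
    by (simp only: diff_conv_add_uminus scal_add_right sum.distrib scal_minus_right sum_negf)
  also have "(\<Sum>i\<in>UNIV. \<Sum>j\<in>UNIV. (?c i j / 2) *\<^sub>k ?Y j i) =
      (\<Sum>i\<in>UNIV. \<Sum>j\<in>UNIV. (?c j i / 2) *\<^sub>k ?Y i j)"
    by (rule sum.swap)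
  also have "(\<Sum>i\<in>UNIV. \<Sum>j\<in>UNIV. (?c i j / 2) *\<^sub>k ?Y i j) - \<dots> =
      (\<Sum>i\<in>UNIV. \<Sum>j\<in>UNIV. (?c i j / 2 - ?c j i / 2) *\<^sub>k ?Y i j)"
    by (simp only: diff_conv_add_uminus scal_add_left sum.distrib scal_minus_left sum_negf)
  also have "\<dots> = (\<Sum>i\<in>UNIV. \<Sum>j\<in>UNIV. ?c i j *\<^sub>k ?Y i j)"
  proof (intro sum.cong refl arg_cong2[where f = scal])
    fix i j
    have "?c i j / 2 - ?c j i / 2 = (?c i j + ?c i j) / 2"
      using skew[of j i] by (simp add: add_divide_distrib)
    then show "?c i j / 2 - ?c j i / 2 = ?c i j" using two by (simp flip: mult_2)
  qed
  also have "\<dots> = \<chi>" by (rule infinitesimal_expansion[OF supp, symmetric])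
  finally show ?thesis unfolding two_coboundary_def by (intro exI[of _ ?\<alpha>]) (rule sym)
qed

theorem proposition4p32:
  fixes A :: "'k::field ^ 'n::{finite,linorder} ^ 'n::{finite,linorder}"
    and \<chi> :: "('n ebasis \<times> 'n ebasis, 'k) alg"
  assumes "CHAR('k) \<noteq> 2"
    and "infinitesimal_R_matrix E_comult (R_mat A) \<chi>"
  shows "cartier E_comult (R_mat A) \<chi> \<longleftrightarrow> two_coboundary E_comult \<chi>"
proof -
  have two: "(2 :: 'k) \<noteq> 0"
  proof
    assume "(2 :: 'k) = 0"
    \<comment> \<open>If 2 vanished, the characteristic would divide 2; it is not 1 because
      \<open>0 \<noteq> 1\<close>, so it would be 2.\<close>
    then have "CHAR('k) dvd 2" using of_nat_eq_0_iff_char_dvd[where 'a = 'k, of 2] by simp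
    then have "CHAR('k) = 1 \<or> CHAR('k) = 2" 
      using two_is_prime_nat unfolding prime_nat_iff by blast
    then show False using assms(1) by (simp add: CHAR_not_1)
  qed
  note supp = infinitesimal_support[OF two assms(2)]
  show ?thesis
    unfolding cartier_iff_skew[OF two assms(2)]
    using two_coboundary_skew two_coboundary_if_skew[OF two supp] by blast
qed

end
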